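(* Let $Q$ be a symmetric function and let $\mu$ be a strict partition. For $n\ge 0$ put $$P(n)=\sum_{|\lambda/\mu|=n}\frac{2^{|\lambda|-|\mu|-\ell(\lambda)+\ell(\mu)}f_{\lambda/\mu}}{H_{\lambda}}\,Q\Bigl(\tbinom{c_{\square}}{2}:\square\in\lambda\Bigr),$$ where the sum ranges over all strict partitions $\lambda\supseteq\mu$ with $|\lambda|-|\mu|=n$. Then $P(n)$ is a polynomial in $n$.
   Context: A strict partition is a finite strictly decreasing sequence of positive integers $\lambda=(\lambda_1>\lambda_2>\cdots>\lambda_\ell)$ (the empty sequence $\emptyset$ is allowed); $|\lambda|=\sum_i\lambda_i$ is its size, $\ell(\lambda)=\ell$ its length, and $\lambda_i=0$ for $i>\ell(\lambda)$. The (shifted Young) diagram of $\lambda$ is the set of boxes $(i,j)$ with $1\le i\le \ell(\lambda)$ and $i+1\le j\le i+\lambda_i$ (row $i$, column $j$); $\lambda$ is identified with its diagram. The content of a box $\square=(i,j)$ is $c_\square=j-i$. The hook length $h_\square$ of $\square=(i,j)\in\lambda$ is the number of boxes of $\lambda$ in row $i$ strictly to the right of $\square$, plus the number of boxes $(i',j)\in\lambda$ with $i'>i$, plus $1$, plus $\lambda_j$. $H_\lambda=\prod_{\square\in\lambda}h_\square$ ($H_\emptyset=1$). For strict partitions write $\lambda\supseteq\mu$ if $\lambda_i\ge\mu_i$ for all $i$; then $\lambda/\mu$ denotes the set of boxes of $\lambda$ not in $\mu$, and $|\lambda/\mu|=|\lambda|-|\mu|$. $f_{\lambda/\mu}$ is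 the number of standard shifted Young tableaux of shape $\lambda/\mu$, i.e. bijective fillings of the boxes of $\lambda/\mu$ with $1,\dots,|\lambda/\mu|$ increasing from left to right along rows and from top to bottom along columns ($f_{\mu/\mu}=1$). For a symmetric function $Q$ (in infinitely many variables), $Q(\binom{c_\square}{2}:\square\in\lambda)$ means that $|\lambda|$ of the variables are specialized to the values $\binom{c_\square}{2}$, $\square\in\lambda$, and all other variables to $0$. *)

theory Defs
  imports "HOL-Computational_Algebra.Polynomial"
begin

definition strict_partition :: "nat list \<Rightarrow> bool" where
  "strict_partition l \<longleftrightarrow> sorted_wrt (>) l \<and> (\<forall>x\<in>set l. 0 < x)"

definition part :: "nat list \<Rightarrow> nat \<Rightarrow> nat" where
  "part l i = (if 1 \<le> i \<and> i \<le> length l then l ! (i - 1) else 0)"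

definition psize :: "nat list \<Rightarrow> nat" where
  "psize l = sum_list l"

definition shifted_diagram :: "nat list \<Rightarrow> (nat \<times> nat) set" where
  "shifted_diagram l = {(i, j). 1 \<le> i \<and> i \<le> length l \<and> i + 1 \<le> j \<and> j \<le> i + part l i}"

definition content :: "nat \<times> nat \<Rightarrow> int" where
  "content b = int (snd b) - int (fst b)"

definition hook :: "nat list \<Rightarrow> nat \<times> nat \<Rightarrow> nat" where
  "hook l b = card {(i', j') \<in> shifted_diagram l. i' = fst b \<and> j' > snd b}
            + card {(i', j') \<in> shifted_diagram l. j' = snd b \<and> i' > fst b}
            + 1 + part l (snd b)"

definition hook_product :: "nat list \<Rightarrow> nat" where
  "hook_product l = (\<Prod>b\<in>shifted_diagram l. hook l b)"

definition pcontains :: "nat list \<Rightarrow> nat list \<Rightarrow> bool" where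
  "pcontains l m \<longleftrightarrow> (\<forall>i. part m i \<le> part l i)"

definition skew_diagram :: "nat list \<Rightarrow> nat list \<Rightarrow> (nat \<times> nat) set" where
  "skew_diagram l m = shifted_diagram l - shifted_diagram m"

definition num_syt :: "nat list \<Rightarrow> nat list \<Rightarrow> nat" where
  "num_syt l m = card {T :: nat \<times> nat \<Rightarrow> nat.
      bij_betw T (skew_diagram l m) {1..card (skew_diagram l m)}
    \<and> (\<forall>b. b \<notin> skew_diagram l m \<longrightarrow> T b = 0)
    \<and> (\<forall>i j j'. (i, j) \<in> skew_diagram l m \<and> (i, j') \<in> skew_diagram l m \<and> j < j'
                 \<longrightarrow> T (i, j) < T (i, j'))
    \<and> (\<forall>i i' j. (i, j) \<in> skew_diagram l m \<and> (i', j) \<in> skew_diagram l m \<and> i < i'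
                 \<longrightarrow> T (i, j) < T (i', j))}"

text \<open>A symmetric function (real coefficients) in variables x_0, x_1, ... is a formal
  power series given by its coefficient function on exponent vectors
  (nat \<Rightarrow> nat, finitely supported), of bounded degree, invariant under
  permutations of the variables.\<close>
definition symmetric_function :: "((nat \<Rightarrow> nat) \<Rightarrow> real) \<Rightarrow> bool" where
  "symmetric_function c \<longleftrightarrow>
     (\<exists>d. \<forall>a. c a \<noteq> 0 \<longrightarrow> finite {i. a i \<noteq> 0} \<and> (\<Sum>i\<in>{i. a i \<noteq> 0}. a i) \<le> d)
   \<and> (\<forall>\<sigma> a. bij \<sigma> \<longrightarrow> c (a \<circ> \<sigma>) = c a)"

text \<open>Specialisation: x_i := xs!i for i < length xs, all other variables := 0.\<close>
definition sf_eval :: "((nat \<Rightarrow> nat) \<Rightarrow> real) \<Rightarrow> real list \<Rightarrow> real" where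
  "sf_eval c xs = (\<Sum>a\<in>{a. (\<forall>i\<ge>length xs. a i = 0) \<and> c a \<noteq> 0}.
                     c a * (\<Prod>i<length xs. (xs ! i) ^ a i))"

definition diagram_list :: "nat list \<Rightarrow> (nat \<times> nat) list" where
  "diagram_list l = concat (map (\<lambda>i. map (\<lambda>j. (i, j)) [i + 1..<i + part l i + 1]) [1..<length l + 1])"

definition content_binoms :: "nat list \<Rightarrow> real list" where
  "content_binoms l = map (\<lambda>b. of_int (content b) * (of_int (content b) - 1) / 2)
                          (diagram_list l)"

definition Pfun :: "((nat \<Rightarrow> nat) \<Rightarrow> real) \<Rightarrow> nat list \<Rightarrow> nat \<Rightarrow> real" where
  "Pfun Q m n = (\<Sum>l\<in>{l. strict_partition l \<and> pcontains l m \<and> psize l = psize m + n}.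
      (2::real) ^ (psize l + length m) / 2 ^ (psize m + length l)
      * real (num_syt l m) / real (hook_product l)
      * sf_eval Q (content_binoms l))"

end

(* Idea. Write u b = b (b + 1) / 2 and v b = b (b - 1) / 2. Boxes can be added to a strict partition
   with set of parts S at the elements a of {0} \<union> S, replacing a by a + 1, and the added box
   contributes the value u a. By the product formula for the hook lengths, the ratio of the weights
   2^(|l| - length l) / H_l of the new and the old partition is the Lagrange weight
   w_a = (\<Prod>b\<in>S. u a - v b) / (\<Prod>b\<in>S \<union> {0} - {a}. u a - u b), which vanishes when a + 1 is already a part.
   Thus P(n + 1) is P(n) with F replaced by its average \<Sum>a. w_a F(l with a raised). The moments
   \<Sum>a. w_a (u a)^k equal 1 for k = 0 and are, by Newton's identities, polynomials of weight at most k
   in the power sums of the values of the boxes (the j-th power sum having weight j + 1). Hence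
   averaging minus identity lowers the weight of F, so iterated differences of P vanish. *)

theory Submission
  imports Defs "HOL-Combinatorics.Permutations" "HOL-Computational_Algebra.Polynomial_FPS"
begin

section \<open>Symmetric functions\<close>

text \<open>The weights are dictated by what adding a box does. Raising \<open>a\<close> turns the
  k-th power sum p_k into p_k + u(a)^k, and averaging trades u(a)^k for the k-th moment, of weight
  k; this is a loss only because p_k weighs k + 1. In a symmetric function of degree d the
  coefficient of u(a)^i has degree d - i, and averaging multiplies it by a moment of weight i; with
  weight twice the degree the loss is i. Working with such coefficients avoids writing Q as a
  polynomial in power sums. That the k-th moment has weight at most k rests on a cancellation.
  Newton's identities involve sum u^r - sum v^r with u(b) = v(b + 1). Each part thus contributes a
  first difference of v^r, hence a sum along its row of second differences, and these are
  polynomials of degree at most r - 1 in the value of the box. Interpolation uses all nodes, even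
  those where raising yields a list that is not a strict partition. What a function does there is
  invisible, because the weight vanishes; so functions are only compared on strict
  partitions.\<close>

definition sym_of_degree :: "nat \<Rightarrow> ((nat \<Rightarrow> nat) \<Rightarrow> real) \<Rightarrow> bool" where
  "sym_of_degree d c \<longleftrightarrow>
     (\<forall>a. c a \<noteq> 0 \<longrightarrow> finite {i. a i \<noteq> 0} \<and> (\<Sum>i\<in>{i. a i \<noteq> 0}. a i) \<le> d)
   \<and> (\<forall>\<sigma> a. bij \<sigma> \<longrightarrow> c (a \<circ> \<sigma>) = c a)"

lemma symmetric_function_degree: "symmetric_function c \<Longrightarrow> \<exists>d. sym_of_degree d c"
  by (auto simp: symmetric_function_def sym_of_degree_def)

lemma sym_of_degree_bij: "sym_of_degree d c \<Longrightarrow> bij \<sigma> \<Longrightarrow> c (a \<circ> \<sigma>) = c a"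
  by (auto simp: sym_of_degree_def)

lemma sym_of_degree_le:
  assumes "sym_of_degree d c" "c a \<noteq> 0"
  shows "a i \<le> d"
proof (cases "a i = 0")
  case False
  have f: "finite {i. a i \<noteq> 0}" and s: "(\<Sum>i\<in>{i. a i \<noteq> 0}. a i) \<le> d"
    using assms by (auto simp: sym_of_degree_def)
  have "a i \<le> (\<Sum>i\<in>{i. a i \<noteq> 0}. a i)"
    by (rule member_le_sum) (use f False in auto)
  then show ?thesis using s by simp
qed simp

definition exponents :: "((nat \<Rightarrow> nat) \<Rightarrow> real) \<Rightarrow> nat \<Rightarrow> (nat \<Rightarrow> nat) set" where
  "exponents c n = {a. (\<forall>i\<ge>n. a i = 0) \<and> c a \<noteq> 0}"

lemma sf_eval_exponents:
  "sf_eval c xs = (\<Sum>a\<in>exponents c (length xs). c a * (\<Prod>i<length xs. (xs ! i) ^ a i))"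
  by (simp add: sf_eval_def exponents_def)

lemma finite_exponents:
  assumes "sym_of_degree d c"
  shows "finite (exponents c n)"
proof (rule finite_subset)
  show "exponents c n \<subseteq> {a. \<forall>i. (i \<in> {..<n} \<longrightarrow> a i \<in> {..d}) \<and> (i \<notin> {..<n} \<longrightarrow> a i = 0)}"
    using sym_of_degree_le[OF assms] by (auto simp: exponents_def)
  show "finite {a. \<forall>i. (i \<in> {..<n} \<longrightarrow> a i \<in> {..d}) \<and> (i \<notin> {..<n} \<longrightarrow> a i = (0::nat))}"
    by (rule finite_set_of_finite_funs) auto
qed

text \<open>Permuting the arguments amounts to composing the exponent vectors with the permutation.
  This is needed because a new box enters \<open>diagram_list\<close> in the middle, not at the
  front.\<close>

lemma sf_eval_mset_eq:
  assumes c: "sym_of_degree d c" and "mset xs = mset ys"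
  shows "sf_eval c xs = sf_eval c ys"
proof -
  obtain f where f: "f permutes {..<length ys}" and xs: "permute_list f ys = xs"
    using mset_eq_permutation[OF assms(2)] by blast
  let ?n = "length ys"
  have len: "length xs = ?n" using xs by (auto simp flip: xs)
  have bf: "bij f" using f by (simp add: permutes_bij)
  have bif: "bij (inv f)" using bf by (simp add: bij_imp_bij_inv)
  have supp: "f i \<ge> ?n \<longleftrightarrow> i \<ge> ?n" for i
    using permutes_in_image[OF f, of i] by auto
  have suppi: "inv f i \<ge> ?n \<longleftrightarrow> i \<ge> ?n" for i
    using permutes_in_image[OF permutes_inv[OF f], of i] by auto
  have eqp: "(\<Prod>i<?n. (xs ! i) ^ (a \<circ> f) i) = (\<Prod>i<?n. (ys ! i) ^ a i)" for a
  proof -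
    have "(\<Prod>i<?n. (xs ! i) ^ (a \<circ> f) i) = (\<Prod>i<?n. (\<lambda>i. (ys ! i) ^ a i) (f i))"
      using f by (intro prod.cong) (auto simp: xs[symmetric] permute_list_nth)
    also have "\<dots> = (\<Prod>i<?n. (ys ! i) ^ a i)"
      using f by (intro prod.reindex_bij_betw permutes_imp_bij)
    finally show ?thesis .
  qed
  have "(\<Sum>a\<in>exponents c ?n. c a * (\<Prod>i<?n. (ys ! i) ^ a i)) = (\<Sum>a\<in>exponents c ?n. c a * (\<Prod>i<?n. (xs ! i) ^ a i))"
  proof (rule sum.reindex_bij_witness[where j = "\<lambda>a. a \<circ> f" and i = "\<lambda>a. a \<circ> inv f"])
    fix a assume a: "a \<in> exponents c ?n"
    show "(a \<circ> f) \<circ> inv f = a" using bf by (simp add: fun_eq_iff bij_is_surj surj_f_inv_f)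
    show "(a \<circ> inv f) \<circ> f = a" using bf by (simp add: fun_eq_iff bij_is_inj inv_f_f)
    show "a \<circ> f \<in> exponents c ?n"
      using a supp sym_of_degree_bij[OF c bf] by (auto simp: exponents_def)
    show "a \<circ> inv f \<in> exponents c ?n"
      using a suppi sym_of_degree_bij[OF c bif] by (auto simp: exponents_def)
    show "c (a \<circ> f) * (\<Prod>i<?n. (xs ! i) ^ (a \<circ> f) i) = c a * (\<Prod>i<?n. (ys ! i) ^ a i)"
      by (simp only: eqp sym_of_degree_bij[OF c bf])
  qed
  then show ?thesis by (simp add: sf_eval_exponents len)
qed

text \<open>The coefficient of the j-th power of the first variable, as a series in the remaining
  variables renumbered from 0.\<close>

definition coeff_fn :: "((nat \<Rightarrow> nat) \<Rightarrow> real) \<Rightarrow> nat \<Rightarrow> (nat \<Rightarrow> nat) \<Rightarrow> real" where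
  "coeff_fn c j a = c (case_nat j a)"

lemma support_case_nat:
  "{i. case_nat j a i \<noteq> (0::nat)} = (if j = 0 then {} else {0}) \<union> Suc ` {i. a i \<noteq> 0}"
proof (rule set_eqI)
  fix i show "i \<in> {i. case_nat j a i \<noteq> (0::nat)} \<longleftrightarrow> i \<in> (if j = 0 then {} else {0}) \<union> Suc ` {i. a i \<noteq> 0}"
    by (cases i) auto
qed

lemma sym_of_degree_coeff_fn:
  assumes c: "sym_of_degree d c"
  shows "sym_of_degree (d - j) (coeff_fn c j)"
  unfolding sym_of_degree_def
proof safe
  fix a assume "coeff_fn c j a \<noteq> 0"
  then have f: "finite {i. case_nat j a i \<noteq> 0}" and s: "(\<Sum>i\<in>{i. case_nat j a i \<noteq> 0}. case_nat j a i) \<le> d"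
    using c unfolding sym_of_degree_def coeff_fn_def by blast+
  show fin: "finite {i. a i \<noteq> 0}" using f unfolding support_case_nat by (auto dest: finite_imageD)
  have "(\<Sum>i\<in>{i. case_nat j a i \<noteq> 0}. case_nat j a i) = (\<Sum>i\<in>insert 0 (Suc ` {i. a i \<noteq> 0}). case_nat j a i)"
    unfolding support_case_nat by (rule sum.mono_neutral_left) (use fin in auto)
  also have "\<dots> = j + (\<Sum>i\<in>{i. a i \<noteq> 0}. a i)"
    using fin by (subst sum.insert) (auto simp: sum.reindex)
  finally show "(\<Sum>i\<in>{i. a i \<noteq> 0}. a i) \<le> d - j" using s by simp
next
  fix \<sigma> :: "nat \<Rightarrow> nat" and a assume b: "bij \<sigma>"
  \<comment> \<open>The permutation of the remaining variables, extended by fixing the first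
    one.\<close>
  let ?s = "case_nat 0 (Suc \<circ> \<sigma>)"
  have "bij ?s"
  proof (rule o_bij)
    show "case_nat 0 (Suc \<circ> inv \<sigma>) \<circ> ?s = id"
      using bij_is_inj[OF b] by (auto simp: fun_eq_iff split: nat.split)
    show "?s \<circ> case_nat 0 (Suc \<circ> inv \<sigma>) = id"
      using bij_is_surj[OF b] by (auto simp: fun_eq_iff surj_f_inv_f split: nat.split)
  qed
  moreover have "case_nat j (a \<circ> \<sigma>) = case_nat j a \<circ> ?s"
    by (auto simp: fun_eq_iff split: nat.splits)
  ultimately show "coeff_fn c j (a \<circ> \<sigma>) = coeff_fn c j a"
    using sym_of_degree_bij[OF c] by (simp add: coeff_fn_def)
qed

text \<open>Putting an exponent 0 in front shifts the variables, and the shift is not a bijection.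
  On exponents supported below n it agrees with a cycle of 0, ..., n, under which c is
  invariant.\<close>

lemma coeff_fn_0:
  assumes c: "sym_of_degree d c" and a: "\<And>i. i \<ge> n \<Longrightarrow> a i = 0"
  shows "coeff_fn c 0 a = c a"
proof -
  let ?s = "\<lambda>i. if i < n then Suc i else if i = n then 0 else i"
  have "bij ?s"
    by (rule o_bij[where g = "\<lambda>i. if i = 0 then n else if i \<le> n then i - 1 else i"]) (auto simp: fun_eq_iff)
  moreover have "case_nat 0 a \<circ> ?s = a" using a by (auto simp: fun_eq_iff split: nat.splits)
  ultimately show ?thesis using sym_of_degree_bij[OF c, of ?s "case_nat 0 a"] by (simp add: coeff_fn_def)
qed

lemma sf_eval_coeff_fn_0:
  assumes c: "sym_of_degree d c"
  shows "sf_eval (coeff_fn c 0) xs = sf_eval c xs"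
proof -
  have "coeff_fn c 0 a = c a" if "\<forall>i\<ge>length xs. a i = 0" for a
    using coeff_fn_0[OF c] that by blast
  then show ?thesis by (auto simp: sf_eval_exponents exponents_def intro!: sum.cong)
qed

lemma sf_eval_Cons:
  assumes c: "sym_of_degree d c"
  shows "sf_eval c (x # xs) = (\<Sum>j\<le>d. x ^ j * sf_eval (coeff_fn c j) xs)"
proof -
  let ?n = "length xs"
  have fin: "finite (exponents (coeff_fn c j) ?n)" for j
    by (rule finite_exponents[OF sym_of_degree_coeff_fn[OF c]])
  have "(\<Sum>j\<le>d. x ^ j * sf_eval (coeff_fn c j) xs)
      = (\<Sum>j\<le>d. \<Sum>a\<in>exponents (coeff_fn c j) ?n. x ^ j * (c (case_nat j a) * (\<Prod>i<?n. (xs ! i) ^ a i)))"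
    by (simp add: sf_eval_exponents sum_distrib_left coeff_fn_def)
  also have "\<dots> = (\<Sum>(j, a)\<in>(SIGMA j:{..d}. exponents (coeff_fn c j) ?n).
      x ^ j * (c (case_nat j a) * (\<Prod>i<?n. (xs ! i) ^ a i)))"
    using fin by (subst sum.Sigma) auto
  also have "\<dots> = (\<Sum>a\<in>exponents c (Suc ?n). c a * (\<Prod>i<Suc ?n. ((x # xs) ! i) ^ a i))"
  proof (rule sum.reindex_bij_witness[where i = "\<lambda>a. (a 0, a \<circ> Suc)" and j = "\<lambda>(j, a). case_nat j a"])
    fix p assume p: "p \<in> (SIGMA j:{..d}. exponents (coeff_fn c j) ?n)"
    obtain j a where [simp]: "p = (j, a)" by (cases p)
    show "((case p of (j, a) \<Rightarrow> case_nat j a) 0, (case p of (j, a) \<Rightarrow> case_nat j a) \<circ> Suc) = p"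
      by (simp add: fun_eq_iff)
    show "(case p of (j, a) \<Rightarrow> case_nat j a) \<in> exponents c (Suc ?n)"
      using p by (auto simp: exponents_def coeff_fn_def split: nat.splits)
    show "c (case p of (j, a) \<Rightarrow> case_nat j a) *
        (\<Prod>i<Suc ?n. ((x # xs) ! i) ^ (case p of (j, a) \<Rightarrow> case_nat j a) i) =
       (case p of (j, a) \<Rightarrow> x ^ j * (c (case_nat j a) * (\<Prod>i<?n. (xs ! i) ^ a i)))"
      by (simp add: prod.lessThan_Suc_shift del: prod.lessThan_Suc)
  next
    fix a assume a: "a \<in> exponents c (Suc ?n)"
    have e: "case_nat (a 0) (a \<circ> Suc) = a" by (auto simp: fun_eq_iff split: nat.splits)
    show "(case (a 0, a \<circ> Suc) of (j, a) \<Rightarrow> case_nat j a) = a" by (simp add: e)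
    show "(a 0, a \<circ> Suc) \<in> (SIGMA j:{..d}. exponents (coeff_fn c j) ?n)"
      using a sym_of_degree_le[OF c, of a 0] by (auto simp: exponents_def coeff_fn_def e)
  qed
  finally show ?thesis by (simp add: sf_eval_exponents)
qed

section \<open>Moments of Lagrange weights\<close>

definition geometric_fps :: "real \<Rightarrow> real fps" where
  "geometric_fps c = Abs_fps (\<lambda>n. c ^ n)"

lemma geometric_fps_mult: "geometric_fps c * (1 - fps_const c * fps_X) = 1"
proof (rule fps_ext)
  fix n
  have "geometric_fps c * (1 - fps_const c * fps_X) = geometric_fps c - geometric_fps c * fps_const c * fps_X"
    by (simp only: right_diff_distrib mult_1_right mult.assoc)
  then show "fps_nth (geometric_fps c * (1 - fps_const c * fps_X)) n = fps_nth (1::real fps) n"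
    by (cases n) (simp_all add: geometric_fps_def)
qed

definition linear_fps_prod :: "('i \<Rightarrow> real) \<Rightarrow> 'i set \<Rightarrow> real fps" where
  "linear_fps_prod u T = (\<Prod>b\<in>T. 1 - fps_const (u b) * fps_X)"

text \<open>The logarithmic derivative of the product: the power sums of the \<open>u b\<close> are
  the coefficients of the last factor.\<close>

lemma fps_deriv_linear_fps_prod:
  assumes "finite T"
  shows "fps_deriv (linear_fps_prod u T) =
    - linear_fps_prod u T * (\<Sum>b\<in>T. fps_const (u b) * geometric_fps (u b))"
  using assms
proof (induction T)
  case (insert x T)
  let ?P = "linear_fps_prod u T" and ?l = "1 - fps_const (u x) * fps_X"
  let ?s = "\<Sum>b\<in>T. fps_const (u b) * geometric_fps (u b)"
  have P: "linear_fps_prod u (insert x T) = ?l * ?P"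
    using insert by (simp add: linear_fps_prod_def)
  have ring: "- c * Q * (g * p) - p * (Q * t) = - (p * Q) * (c * g + t)" for c Q g p t :: "real fps"
    by (simp add: algebra_simps)
  have ring': "p * (- Q * t) + - c * Q = - c * Q - p * (Q * t)" for c Q p t :: "real fps"
    by (simp add: algebra_simps)
  have d: "fps_deriv ?l = - fps_const (u x)" by simp
  have "fps_deriv (linear_fps_prod u (insert x T)) = - fps_const (u x) * ?P - ?l * (?P * ?s)"
    unfolding P fps_deriv_mult insert.IH d by (rule ring')
  \<comment> \<open>The factor \<open>geometric_fps (u x) * ?l\<close> equals 1; inserting it allows
    \<open>?l * ?P\<close> to be pulled out of both terms.\<close>
  also have "\<dots> = - fps_const (u x) * ?P * (geometric_fps (u x) * ?l) - ?l * (?P * ?s)"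
    by (simp only: geometric_fps_mult mult_1_right)
  also have "\<dots> = - (?l * ?P) * (fps_const (u x) * geometric_fps (u x) + ?s)"
    by (rule ring)
  finally show ?case unfolding P sum.insert[OF insert.hyps] .
qed (simp add: linear_fps_prod_def)

text \<open>The residue at z = \<open>u a\<close> of the rational function with zeros
  \<open>v b\<close> (b in S) and simple poles \<open>u b\<close> (b in T).\<close>

definition interp_weight :: "('i \<Rightarrow> real) \<Rightarrow> ('i \<Rightarrow> real) \<Rightarrow> 'i set \<Rightarrow> 'i set \<Rightarrow> 'i \<Rightarrow> real" where
  "interp_weight u v S T a = (\<Prod>b\<in>S. u a - v b) / (\<Prod>b\<in>T - {a}. u a - u b)"

text \<open>Both sides are polynomials in z of degree at most \<open>card S\<close> that agree at
  the \<open>card S + 1\<close> distinct points \<open>u a\<close>.\<close>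

lemma lagrange_at:
  fixes u v :: "'i \<Rightarrow> real"
  assumes fin: "finite S" "finite T" and inj: "inj_on u T" and card: "card T = Suc (card S)"
  shows "(\<Sum>a\<in>T. interp_weight u v S T a * (\<Prod>b\<in>T - {a}. z - u b)) = (\<Prod>b\<in>S. z - v b)"
proof -
  let ?p = "\<Sum>a\<in>T. smult (interp_weight u v S T a) (\<Prod>b\<in>T - {a}. [:- u b, 1:])"
  let ?q = "\<Prod>b\<in>S. [:- v b, 1:]"
  have "?p = ?q"
  proof (rule poly_eqI_degree[where A = "u ` T"])
    fix x assume "x \<in> u ` T"
    then obtain a where a: "a \<in> T" "x = u a" by auto
    have "poly ?p x = (\<Sum>a'\<in>T. interp_weight u v S T a' * (\<Prod>b\<in>T - {a'}. u a - u b))"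
      by (simp add: poly_sum poly_prod a)
    also have "\<dots> = (\<Sum>a'\<in>{a}. interp_weight u v S T a' * (\<Prod>b\<in>T - {a'}. u a - u b))"
      by (rule sum.mono_neutral_right) (use a fin in auto)
    also have "\<dots> = (\<Prod>b\<in>S. u a - v b)"
      using fin inj a by (auto simp: interp_weight_def prod_zero_iff inj_on_def)
    finally show "poly ?p x = poly ?q x" by (simp add: poly_prod a)
  next
    have "degree (\<Prod>b\<in>T - {a}. [:- u b, 1:]) \<le> card S" if "a \<in> T" for a
      using degree_prod_sum_le[of "T - {a}" "\<lambda>b. [:- u b, 1:]"] that fin card by (simp add: card_Diff_singleton)
    then have "degree ?p \<le> card S"
      using fin by (intro degree_sum_le) (auto intro: order.trans[OF degree_smult_le])
    then show "degree ?p < card (u ` T)" using card by (simp add: card_image inj)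
    have "degree ?q \<le> card S"
      using degree_prod_sum_le[of S "\<lambda>b. [:- v b, 1:]"] fin by simp
    then show "degree ?q < card (u ` T)" using card by (simp add: card_image inj)
  qed
  then have "poly ?p z = poly ?q z" by simp
  then show ?thesis by (simp add: poly_sum poly_prod)
qed

definition moment :: "('i \<Rightarrow> real) \<Rightarrow> ('i \<Rightarrow> real) \<Rightarrow> 'i set \<Rightarrow> 'i set \<Rightarrow> nat \<Rightarrow> real" where
  "moment u v S T k = (\<Sum>a\<in>T. interp_weight u v S T a * u a ^ k)"

context
  fixes u v :: "'i \<Rightarrow> real" and S T :: "'i set"
  assumes fin: "finite S" "finite T" and inj: "inj_on u T" and card: "card T = Suc (card S)"
begin

text \<open>The partial fraction expansion read at infinity: with z = 1/t,
  \<open>lagrange_at\<close> becomes an identity of polynomials in t, and expanding 1 / (1 - u(a) t)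
  as a geometric series produces the moments.\<close>

lemma moment_fps_mult:
  "Abs_fps (moment u v S T) * linear_fps_prod u T = linear_fps_prod v S"
proof -
  let ?w = "interp_weight u v S T"
  have "(\<Sum>a\<in>T. smult (?w a) (\<Prod>b\<in>T - {a}. [:1, - u b:])) = (\<Prod>b\<in>S. [:1, - v b:])" (is "?p = ?q")
  \<comment> \<open>The substitution z = 1/t reaches only nonzero t, which is enough to identify two
    polynomials.\<close>
  proof (rule ccontr)
    assume "?p \<noteq> ?q"
    then have "finite {x. poly (?p - ?q) x = 0}" by (intro poly_roots_finite) auto
    moreover have "poly ?p t = poly ?q t" if t: "t \<noteq> 0" for t
    proof -
      have e: "1 - c * t = t * (1 / t - c)" for c using t by (simp add: field_simps)
      have "poly ?p t = (\<Sum>a\<in>T. ?w a * (\<Prod>b\<in>T - {a}. t * (1 / t - u b)))"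
        by (simp add: poly_sum poly_prod e[symmetric] mult.commute)
      \<comment> \<open>One node is left out of \<open>T - {a}\<close>, so it has
        \<open>card S\<close> elements and the same power of t comes out on both sides.\<close>
      also have "\<dots> = (\<Sum>a\<in>T. t ^ card S * (?w a * (\<Prod>b\<in>T - {a}. 1 / t - u b)))"
        using fin card by (intro sum.cong refl) (simp only: prod.distrib, simp)
      also have "\<dots> = t ^ card S * (\<Prod>b\<in>S. 1 / t - v b)"
        by (simp only: lagrange_at[OF fin inj card] flip: sum_distrib_left)
      also have "\<dots> = (\<Prod>b\<in>S. t * (1 / t - v b))" by (simp add: prod.distrib)
      also have "\<dots> = poly ?q t" by (simp add: poly_prod e[symmetric] mult.commute)
      finally show ?thesis .
    qed
    then have "{x. x \<noteq> 0} \<subseteq> {x. poly (?p - ?q) x = 0}" by auto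
    ultimately have "finite {x::real. x \<noteq> 0}" using finite_subset by blast
    then have "finite (insert 0 {x::real. x \<noteq> 0})" by simp
    moreover have "insert 0 {x::real. x \<noteq> 0} = UNIV" by auto
    ultimately show False using infinite_UNIV_char_0 by metis
  qed
  then have "fps_of_poly ?p = fps_of_poly ?q" by simp
  moreover have lin: "fps_of_poly [:1, - c:] = 1 - fps_const c * fps_X" for c :: real
    by (simp add: fps_of_poly_linear')
  ultimately have eq: "(\<Sum>a\<in>T. fps_const (?w a) * linear_fps_prod u (T - {a})) = linear_fps_prod v S"
    by (simp add: fps_of_poly_sum fps_of_poly_prod fps_of_poly_smult linear_fps_prod_def)
  have "Abs_fps (moment u v S T) = (\<Sum>a\<in>T. fps_const (?w a) * geometric_fps (u a))"
    by (simp add: fps_eq_iff fps_sum_nth geometric_fps_def moment_def)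
  then have "Abs_fps (moment u v S T) * linear_fps_prod u T
      = (\<Sum>a\<in>T. fps_const (?w a) * (geometric_fps (u a) * linear_fps_prod u T))"
    by (simp add: sum_distrib_right mult.assoc)
  also have "\<dots> = (\<Sum>a\<in>T. fps_const (?w a) * linear_fps_prod u (T - {a}))"
  proof (intro sum.cong refl arg_cong2[where f = "(*)"])
    fix a assume "a \<in> T"
    then have "linear_fps_prod u T = (1 - fps_const (u a) * fps_X) * linear_fps_prod u (T - {a})"
      unfolding linear_fps_prod_def using fin by (intro prod.remove)
    then show "geometric_fps (u a) * linear_fps_prod u T = linear_fps_prod u (T - {a})"
      by (simp only: mult.assoc[symmetric] geometric_fps_mult mult_1)
  qed
  finally show ?thesis using eq by simp
qed

lemma moment_0: "moment u v S T 0 = 1"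
proof -
  have z: "fps_nth (linear_fps_prod w A) 0 = 1" for w :: "'i \<Rightarrow> real" and A
    unfolding linear_fps_prod_def by (induction A rule: infinite_finite_induct) auto
  have "fps_nth (Abs_fps (moment u v S T) * linear_fps_prod u T) 0 = 1"
    by (simp only: moment_fps_mult z)
  then show ?thesis by (simp add: z)
qed

text \<open>The generating function R of the moments is a quotient of products, so its logarithmic
  derivative is U - V, a difference of power sum series. The claim compares coefficients in R' = (U
  - V) R.\<close>

lemma moment_newton:
  "real (Suc k) * moment u v S T (Suc k) =
    (\<Sum>r\<le>k. ((\<Sum>b\<in>T. u b ^ Suc r) - (\<Sum>b\<in>S. v b ^ Suc r)) * moment u v S T (k - r))"
proof -
  define R where "R = Abs_fps (moment u v S T)"
  define U where "U = (\<Sum>b\<in>T. fps_const (u b) * geometric_fps (u b))"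
  define V where "V = (\<Sum>b\<in>S. fps_const (v b) * geometric_fps (v b))"
  let ?A = "linear_fps_prod u T" and ?B = "linear_fps_prod v S"
  have RA: "R * ?A = ?B" by (simp add: R_def moment_fps_mult)
  have "fps_deriv R * ?A - R * ?A * U = - ?B * V"
    using arg_cong[OF RA, of fps_deriv]
    by (simp add: fps_deriv_linear_fps_prod fin U_def V_def algebra_simps)
  then have "?A * fps_deriv R = ?A * ((U - V) * R)"
    by (simp add: RA[symmetric] algebra_simps)
  moreover have "?A \<noteq> 0"
  proof
    assume "?A = 0"
    then have "fps_nth ?A 0 = 0" by simp
    moreover have "fps_nth ?A 0 = 1"
      unfolding linear_fps_prod_def by (induction T rule: infinite_finite_induct) auto
    ultimately show False by simp
  qed
  ultimately have "fps_deriv R = (U - V) * R" by simp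
  then have "fps_nth (fps_deriv R) k = (\<Sum>r=0..k. fps_nth (U - V) r * fps_nth R (k - r))"
    by (simp only: fps_mult_nth)
  moreover have "fps_nth (fps_deriv R) k = real (Suc k) * moment u v S T (Suc k)"
    by (simp add: R_def)
  moreover have "fps_nth (U - V) r = (\<Sum>b\<in>T. u b ^ Suc r) - (\<Sum>b\<in>S. v b ^ Suc r)" for r
    by (simp add: U_def V_def fps_sum_nth geometric_fps_def)
  moreover have "fps_nth R r = moment u v S T r" for r
    by (simp add: R_def)
  ultimately show ?thesis
    by (simp only: atLeast0AtMost)
qed
end

section \<open>Shifted diagrams\<close>

lemma mem_shifted_diagram: "(i, j) \<in> shifted_diagram l \<longleftrightarrow> 1 \<le> i \<and> i < j \<and> j \<le> i + part l i"
  by (auto simp: shifted_diagram_def part_def)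

lemma part_0 [simp]: "part l 0 = 0"
  by (simp add: part_def)

lemma part_Suc: "part l (Suc i) = (if i < length l then l ! i else 0)"
  by (auto simp: part_def)

lemma strict_partition_distinct: "strict_partition l \<Longrightarrow> distinct l"
  by (auto simp: strict_partition_def distinct_conv_nth sorted_wrt_iff_nth_less) (metis linorder_neq_iff)

lemma part_mem_set: "part l i \<in> insert 0 (set l)"
  by (auto simp: part_def)

lemma part_pos_iff: "strict_partition l \<Longrightarrow> part l i > 0 \<longleftrightarrow> 1 \<le> i \<and> i \<le> length l"
  by (auto simp: part_def strict_partition_def)

lemma part_less:
  assumes "strict_partition l" "1 \<le> i" "i < j" "part l i > 0"
  shows "part l j < part l i"
proof (cases "j \<le> length l")
  case True
  then show ?thesis using assms by (auto simp: part_def strict_partition_def sorted_wrt_iff_nth_less)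
next
  case False
  then have "part l j = 0" by (auto simp: part_def)
  then show ?thesis using assms(4) by simp
qed

lemma part_inject:
  assumes "strict_partition l" "1 \<le> i" "1 \<le> j" "part l i = part l j" "part l i > 0"
  shows "i = j"
  using part_less[of l i j] part_less[of l j i] assms by (metis linorder_neq_iff)

text \<open>Row i ends in column i + \<open>part l i\<close>. As the parts drop by at least 1 per
  row, these right ends never move to the right.\<close>

lemma part_add_index_antimono:
  assumes "strict_partition l" "1 \<le> i" "i \<le> k" "k \<le> length l"
  shows "part l k + k \<le> part l i + i"
  using assms(3,4)
proof (induction k rule: dec_induct)
  case (step n)
  then have "part l (Suc n) < part l n"
    using part_less[OF assms(1), of n "Suc n"] part_pos_iff[OF assms(1), of n] assms(2) by simp
  then show ?case using step by simp
qed simp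

lemma mem_set_part_iff:
  "x \<in> set l \<longleftrightarrow> (\<exists>i. 1 \<le> i \<and> i \<le> length l \<and> part l i = x)"
proof
  assume "x \<in> set l"
  then obtain k where "k < length l" "l ! k = x" by (auto simp: in_set_conv_nth)
  then show "\<exists>i. 1 \<le> i \<and> i \<le> length l \<and> part l i = x"
    by (intro exI[of _ "Suc k"]) (auto simp: part_Suc)
qed (auto simp: part_def)

lemma strict_partition_eqI:
  assumes "strict_partition l" "strict_partition m" "\<And>i. 1 \<le> i \<Longrightarrow> part l i = part m i"
  shows "l = m"
proof -
  have pos: "i \<le> length l \<longleftrightarrow> i \<le> length m" if "1 \<le> i" for i
    using part_pos_iff[OF assms(1), of i] part_pos_iff[OF assms(2), of i] assms(3)[OF that] that by simp
  have "length l = length m"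
    using pos[of "length l"] pos[of "length m"] by (cases l; cases m) auto
  then show ?thesis
  proof (rule nth_equalityI)
    fix i assume "i < length l"
    then show "l ! i = m ! i" using assms(3)[of "Suc i"] \<open>length l = length m\<close> by (simp add: part_Suc)
  qed
qed

lemma strict_partition_partI:
  assumes "\<And>i. 1 \<le> i \<Longrightarrow> i \<le> length l \<Longrightarrow> part l i > 0"
    and "\<And>i. 1 \<le> i \<Longrightarrow> i < length l \<Longrightarrow> part l (Suc i) < part l i"
  shows "strict_partition l"
  unfolding strict_partition_def
proof
  have "transp ((>) :: nat \<Rightarrow> nat \<Rightarrow> bool)" by (auto simp: transp_def)
  moreover have "l ! Suc i < l ! i" if "Suc i < length l" for i
    using assms(2)[of "Suc i"] that by (simp add: part_Suc)
  ultimately show "sorted_wrt (>) l" by (simp add: sorted_wrt_iff_nth_Suc_transp)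
  show "\<forall>x\<in>set l. 0 < x" using assms(1) by (auto simp: mem_set_part_iff)
qed

lemma shifted_diagram_inject:
  assumes "shifted_diagram l = shifted_diagram m"
  shows "part l i = part m i"
proof (cases "1 \<le> i")
  case True
  then have "i < j \<and> j \<le> i + part l i \<longleftrightarrow> i < j \<and> j \<le> i + part m i" for j
    using assms mem_shifted_diagram[of i j l] mem_shifted_diagram[of i j m] by auto
  from this[of "i + part l i"] this[of "i + part m i"] show ?thesis by auto
qed (auto simp: part_def)

lemma pcontains_iff_subset: "pcontains l m \<longleftrightarrow> shifted_diagram m \<subseteq> shifted_diagram l"
proof
  assume "pcontains l m"
  then show "shifted_diagram m \<subseteq> shifted_diagram l"
    unfolding pcontains_def by (force simp: mem_shifted_diagram intro: order.trans)
next
  assume s: "shifted_diagram m \<subseteq> shifted_diagram l"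
  show "pcontains l m"
    unfolding pcontains_def
  proof
    fix i show "part m i \<le> part l i"
    proof (rule ccontr)
      assume "\<not> part m i \<le> part l i"
      moreover from this have "1 \<le> i" by (auto simp: part_def split: if_splits)
      ultimately have "(i, i + part m i) \<in> shifted_diagram m" "(i, i + part m i) \<notin> shifted_diagram l"
        by (auto simp: mem_shifted_diagram)
      then show False using s by blast
    qed
  qed
qed

lemma shifted_diagram_Sigma: "shifted_diagram l = (SIGMA i:{1..length l}. {i + 1..i + part l i})"
  by (auto simp: shifted_diagram_def)

lemma finite_shifted_diagram [simp]: "finite (shifted_diagram l)"
  by (simp add: shifted_diagram_Sigma)

text \<open>The contents in a row of length x are 1, ..., x; as parts are distinct, rows can be
  indexed by the set of parts.\<close>

lemma sum_shifted_diagram: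
  fixes g :: "nat \<Rightarrow> 'a::comm_monoid_add"
  assumes "strict_partition l"
  shows "(\<Sum>b\<in>shifted_diagram l. g (snd b - fst b)) = (\<Sum>x\<in>set l. \<Sum>c\<in>{1..x}. g c)"
proof -
  have shift: "(\<Sum>j\<in>{i + 1..i + x}. g (j - i)) = (\<Sum>c\<in>{1..x}. g c)" for i x :: nat
    by (rule sum.reindex_bij_witness[where i = "\<lambda>c. i + c" and j = "\<lambda>j. j - i"]) auto
  have "(\<Sum>b\<in>shifted_diagram l. g (snd b - fst b)) = (\<Sum>i\<in>{1..length l}. \<Sum>j\<in>{i + 1..i + part l i}. g (j - i))"
    unfolding shifted_diagram_Sigma by (subst sum.Sigma) (auto simp: case_prod_beta)
  also have "\<dots> = (\<Sum>i\<in>{1..length l}. \<Sum>c\<in>{1..part l i}. g c)"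
    by (simp only: shift)
  also have "\<dots> = (\<Sum>x\<in>part l ` {1..length l}. \<Sum>c\<in>{1..x}. g c)"
  proof (subst sum.reindex)
    show "inj_on (part l) {1..length l}"
      using part_inject[OF assms] part_pos_iff[OF assms] by (auto intro!: inj_onI)
  qed simp
  also have "part l ` {1..length l} = set l"
    by (auto simp: mem_set_part_iff)
  finally show ?thesis .
qed

lemma psize_eq_sum: "strict_partition l \<Longrightarrow> psize l = \<Sum>(set l)"
  by (simp add: psize_def strict_partition_distinct distinct_sum_list_conv_Sum)

lemma psize_eq_card:
  assumes "strict_partition l" shows "psize l = card (shifted_diagram l)"
  using sum_shifted_diagram[OF assms, of "\<lambda>_. 1::nat"] by (simp add: psize_eq_sum assms)

definition box_binom :: "nat \<times> nat \<Rightarrow> real" where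
  "box_binom b = of_int (content b) * (of_int (content b) - 1) / 2"

lemma mset_content_binoms:
  "mset (content_binoms l) = image_mset box_binom (mset_set (shifted_diagram l))"
proof -
  have set: "set (diagram_list l) = shifted_diagram l"
    unfolding diagram_list_def shifted_diagram_Sigma by (force simp del: upt_Suc)
  have rows: "distinct (concat (map (\<lambda>i. map (Pair i) [i + 1..<i + p i + 1]) [m..<n]))" for p :: "nat \<Rightarrow> nat" and m n
    by (induction n) (auto simp: distinct_map inj_on_def)
  have "distinct (diagram_list l)"
    unfolding diagram_list_def by (rule rows)
  then have "mset (diagram_list l) = mset_set (shifted_diagram l)"
    by (metis set mset_set_set)
  then show ?thesis by (simp add: content_binoms_def box_binom_def[abs_def])
qed

text \<open>Appending a part 1 is treated as replacing a part 0 by 1.\<close>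

definition raise :: "nat list \<Rightarrow> nat \<Rightarrow> nat list" where
  "raise l a = map (\<lambda>x. if x = a then Suc a else x) l @ (if a = 0 then [1] else [])"

lemma part_raise:
  assumes l: "strict_partition l" and a: "a \<in> insert 0 (set l)"
  obtains i where "1 \<le> i" "part l i = a"
    "\<And>k. part (raise l a) k = (if k = i then Suc a else part l k)"
proof (cases "a = 0")
  case True
  have "0 \<notin> set l" using l by (auto simp: strict_partition_def)
  then have "map (\<lambda>x. if x = 0 then Suc 0 else x) l = l"
    by (intro map_idI) metis
  then have r: "raise l 0 = l @ [1]" unfolding raise_def by simp
  show ?thesis
    by (rule that[of "Suc (length l)"]) (auto simp: r part_def nth_append True)
next
  case False
  then obtain i where i: "1 \<le> i" "i \<le> length l" "part l i = a"
    using a mem_set_part_iff[of a l] by auto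
  have r: "raise l a = map (\<lambda>x. if x = a then Suc a else x) l" using False by (simp add: raise_def)
  have "part (raise l a) k = (if part l k = a then Suc a else part l k)" for k
    using False by (auto simp: r part_def)
  moreover have "part l k = a \<longleftrightarrow> k = i" for k
  proof
    assume p: "part l k = a"
    then have "1 \<le> k" using False by (cases k) auto
    then show "k = i" using part_inject[OF l i(1), of k] i(3) p False by simp
  qed (use i in simp)
  ultimately show ?thesis using that[of i] i by simp
qed

lemma set_raise:
  "strict_partition l \<Longrightarrow> a \<in> insert 0 (set l) \<Longrightarrow> set (raise l a) = insert (Suc a) (set l - {a})"
  by (auto simp: raise_def strict_partition_def)

lemma length_raise: "length (raise l a) = length l + (if a = 0 then 1 else 0)"
  by (simp add: raise_def)

lemma strict_partition_raise:
  assumes "strict_partition l" "Suc a \<notin> set l"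
  shows "strict_partition (raise l a)"
proof -
  have "sorted_wrt (\<lambda>x y. (if y = a then Suc a else y) < (if x = a then Suc a else x)) l"
    by (rule sorted_wrt_mono_rel[where P = "(>)"]) (use assms in \<open>auto simp: strict_partition_def not_less_eq_eq intro: Suc_lessI\<close>)
  then show ?thesis
    using assms by (auto simp: strict_partition_def raise_def sorted_wrt_append sorted_wrt_map intro: Suc_lessI)
qed

section \<open>Adding and removing a single box\<close>

definition covers :: "nat list \<Rightarrow> nat list \<Rightarrow> bool" where
  "covers m l \<longleftrightarrow> strict_partition m \<and> strict_partition l \<and>
     (\<exists>b. b \<notin> shifted_diagram m \<and> shifted_diagram l = insert b (shifted_diagram m))"

text \<open>This holds at every node: if \<open>Suc a\<close> is already a part,
  \<open>raise l a\<close> repeats it, but the diagram still gains exactly one box. Averages can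
  therefore run over all nodes. The new box has content a + 1.\<close>

lemma shifted_diagram_raise:
  assumes "strict_partition l" "a \<in> insert 0 (set l)"
  obtains b where "b \<notin> shifted_diagram l" "shifted_diagram (raise l a) = insert b (shifted_diagram l)"
    "box_binom b = real a * (real a + 1) / 2"
proof -
  obtain i where i: "1 \<le> i" "part l i = a" "\<And>k. part (raise l a) k = (if k = i then Suc a else part l k)"
    using part_raise[OF assms] by blast
  show ?thesis
  proof (rule that[of "(i, i + Suc a)"])
    show "(i, i + Suc a) \<notin> shifted_diagram l" using i by (simp add: mem_shifted_diagram)
    show "shifted_diagram (raise l a) = insert (i, i + Suc a) (shifted_diagram l)"
    proof (rule set_eqI)
      fix x show "x \<in> shifted_diagram (raise l a) \<longleftrightarrow> x \<in> insert (i, i + Suc a) (shifted_diagram l)"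
        using i by (cases x) (auto simp: mem_shifted_diagram)
    qed
    show "box_binom (i, i + Suc a) = real a * (real a + 1) / 2"
      by (simp add: box_binom_def content_def algebra_simps)
  qed
qed

lemma covers_raise:
  assumes "strict_partition l" "a \<in> insert 0 (set l)" "Suc a \<notin> set l"
  shows "covers l (raise l a)"
  using shifted_diagram_raise[OF assms(1,2)] strict_partition_raise[OF assms(1,3)] assms(1)
  unfolding covers_def by metis

lemma psize_covers: "covers m l \<Longrightarrow> psize l = Suc (psize m)"
  by (auto simp: covers_def psize_eq_card)

lemma content_binoms_raise:
  assumes "strict_partition l" "a \<in> insert 0 (set l)"
  shows "mset (content_binoms (raise l a)) = mset (real a * (real a + 1) / 2 # content_binoms l)"
proof -
  obtain b where "b \<notin> shifted_diagram l" "shifted_diagram (raise l a) = insert b (shifted_diagram l)"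
    "box_binom b = real a * (real a + 1) / 2"
    using shifted_diagram_raise[OF assms] .
  then show ?thesis by (simp add: mset_content_binoms)
qed

lemma inj_on_raise:
  assumes "strict_partition l"
  shows "inj_on (raise l) (insert 0 (set l))"
proof (rule inj_onI)
  fix a a' assume a: "a \<in> insert 0 (set l)" "a' \<in> insert 0 (set l)" "raise l a = raise l a'"
  then have e: "insert (Suc a) (set l - {a}) = insert (Suc a') (set l - {a'})"
    using set_raise[OF assms] by metis
  show "a = a'"
  proof (rule ccontr)
    assume n: "a \<noteq> a'"
    consider "a \<in> set l" | "a' \<in> set l" using a n by auto
    then show False
    proof cases
      case 1 then have "a \<in> insert (Suc a') (set l - {a'})" using n by simp
      then show False using e by (metis Diff_iff insert_iff n_not_Suc_n)
    next
      case 2 then have "a' \<in> insert (Suc a) (set l - {a})" using n by simp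
      then show False using e by (metis Diff_iff insert_iff n_not_Suc_n)
    qed
  qed
qed

text \<open>The extra box must extend a row by one. Were the increased length already a part, l
  would have two equal parts.\<close>

lemma coversE:
  assumes "covers m l"
  obtains a where "a \<in> insert 0 (set m)" "Suc a \<notin> set m" "l = raise m a"
proof -
  obtain i j where sm: "strict_partition m" and sl: "strict_partition l" and b: "(i, j) \<notin> shifted_diagram m"
    and d: "shifted_diagram l = insert (i, j) (shifted_diagram m)"
    using assms by (auto simp: covers_def)
  let ?a = "part m i"
  have mem: "(i', j') \<in> shifted_diagram l \<longleftrightarrow> (i' = i \<and> j' = j) \<or> (i', j') \<in> shifted_diagram m" for i' j'
    using d by auto
  have ij: "1 \<le> i" "i < j" "j \<le> i + part l i" using mem[of i j] by (auto simp: mem_shifted_diagram)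
  have j: "i + part m i < j" using b ij by (auto simp: mem_shifted_diagram)
  \<comment> \<open>The first free place of row i is not to the right of (i, j), so it lies in l as
    well and must be the extra box.\<close>
  have j': "j = i + part m i + 1"
    using mem[of i "i + part m i + 1"] ij j by (auto simp: mem_shifted_diagram)
  have pi: "part l i = Suc ?a"
    using mem[of i "i + part m i + 2"] ij j j' by (auto simp: mem_shifted_diagram)
  have pk: "part l k = part m k" if "k \<noteq> i" for k
  proof (cases "1 \<le> k")
    case True
    then show ?thesis
      using mem[of k "k + part l k"] mem[of k "k + part m k"] that by (auto simp: mem_shifted_diagram)
  qed (auto simp: part_def)
  have a: "?a \<in> insert 0 (set m)" by (rule part_mem_set)
  have Suca: "Suc ?a \<notin> set m"
  proof
    assume "Suc ?a \<in> set m"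
    then obtain k where k: "1 \<le> k" "part m k = Suc ?a" by (auto simp: mem_set_part_iff)
    then have "k \<noteq> i" by auto
    then have "part l k = part l i" using pk pi k by simp
    then show False using part_inject[OF sl, of k i] k ij pi \<open>k \<noteq> i\<close> by simp
  qed
  obtain i' where i': "1 \<le> i'" "part m i' = ?a" "\<And>k. part (raise m ?a) k = (if k = i' then Suc ?a else part m k)"
    using part_raise[OF sm a] by blast
  \<comment> \<open>A positive length determines its row. For length 0 both i and i' must be the
    first empty row, since in a strict partition no empty row precedes a nonempty one.\<close>
  have "i' = i"
  proof (cases "?a = 0")
    case False then show ?thesis using part_inject[OF sm, of i' i] i' ij by simp
  next
    case True
    have sr: "strict_partition (raise m ?a)" by (rule strict_partition_raise[OF sm Suca])
    show ?thesis
    proof (rule linorder_cases[of i i'])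
      assume "i < i'"
      then have "part (raise m ?a) i' < part (raise m ?a) i \<or> part (raise m ?a) i = 0"
        using part_less[OF sr, of i i'] ij by auto
      moreover have "part (raise m ?a) i = 0" using i'(3)[of i] \<open>i < i'\<close> True by simp
      moreover have "part (raise m ?a) i' > 0" using i'(3)[of i'] by simp
      ultimately show ?thesis
        using part_pos_iff[OF sr, of i] part_pos_iff[OF sr, of i'] \<open>i < i'\<close> ij by simp
    next
      assume "i' < i"
      then have "part l i' = 0" using pk[of i'] i' True by simp
      moreover have "part l i > 0" using pi by simp
      ultimately show ?thesis
        using part_pos_iff[OF sl, of i] part_pos_iff[OF sl, of i'] \<open>i' < i\<close> i'(1) by simp
    qed simp
  qed
  then have "l = raise m ?a"
    using i'(3) pi pk by (intro strict_partition_eqI[OF sl strict_partition_raise[OF sm Suca]]) auto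
  then show ?thesis using that a Suca by blast
qed

lemma covers_eq_raise:
  assumes "strict_partition m"
  shows "{l. covers m l} = raise m ` {a \<in> insert 0 (set m). Suc a \<notin> set m}"
  using covers_raise[OF assms] by (auto elim: coversE)

lemma covers_remove_corner:
  assumes l: "strict_partition l" and b: "(i, j) \<in> shifted_diagram l"
    and right: "(i, Suc j) \<notin> shifted_diagram l" and below: "(Suc i, j) \<notin> shifted_diagram l"
  obtains m where "covers m l" "shifted_diagram m = shifted_diagram l - {(i, j)}"
proof -
  have i: "1 \<le> i" "i < j" and pi: "part l i > 0" and j: "j = i + part l i"
    using b right by (auto simp: mem_shifted_diagram)
  have il: "i \<le> length l" using pi part_pos_iff[OF l] by simp
  have down: "part l (Suc i) < part l i" using part_less[OF l, of i "Suc i"] i pi by simp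
  have "\<exists>m. strict_partition m \<and> (\<forall>k. part m k = (if k = i then part l i - 1 else part l k))"
  \<comment> \<open>A part must not become 0. A row of length 1 is the last one and is dropped from
    the list instead of being decreased.\<close>
  proof (cases "part l i = 1")
    case True
    then have "part l (Suc i) = 0" using down by simp
    then have "length l = i" using part_pos_iff[OF l, of "Suc i"] il by simp
    then have "\<forall>k. part (butlast l) k = (if k = i then part l i - 1 else part l k)"
      using True i by (auto simp: part_def nth_butlast)
    moreover have "strict_partition (butlast l)"
      using l by (auto simp: strict_partition_def butlast_conv_take sorted_wrt_take dest: in_set_takeD)
    ultimately show ?thesis by blast
  next
    case False
    define m where "m = l[i - 1 := part l i - 1]"
    have p: "part m k = (if k = i then part l i - 1 else part l k)" for k
      using i il by (auto simp: m_def part_def nth_list_update)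
    have [simp]: "length m = length l" by (simp add: m_def)
    \<comment> \<open>As row i has at least two boxes, \<open>Suc i < j\<close>; so the absence of
      the box below means that row \<open>Suc i\<close> ends before column j.\<close>
    have d: "part l (Suc i) < part l i - 1"
      using below i j down False pi by (auto simp: mem_shifted_diagram)
    have "strict_partition m"
    proof (rule strict_partition_partI)
      fix k assume k: "1 \<le> k" "k \<le> length m"
      then show "part m k > 0" using part_pos_iff[OF l, of k] False pi by (auto simp: p)
    next
      fix k assume k: "1 \<le> k" "k < length m"
      then have "part l (Suc k) < part l k"
        using part_less[OF l, of k "Suc k"] part_pos_iff[OF l, of k] by simp
      then show "part m (Suc k) < part m k" using d by (auto simp: p)
    qed
    then show ?thesis using p by blast
  qed
  then obtain m where m: "strict_partition m" "\<And>k. part m k = (if k = i then part l i - 1 else part l k)"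
    by blast
  have d: "shifted_diagram m = shifted_diagram l - {(i, j)}"
  proof (rule set_eqI)
    fix x show "x \<in> shifted_diagram m \<longleftrightarrow> x \<in> shifted_diagram l - {(i, j)}"
      using j pi by (cases x) (auto simp: mem_shifted_diagram m(2))
  qed
  then have "covers m l" using b m(1) l unfolding covers_def by blast
  then show ?thesis using d that by blast
qed

lemma finite_strict_partitions: "finite {l. strict_partition l \<and> P l \<and> psize l = n}"
proof (rule finite_subset)
  have "length l \<le> sum_list l" if "\<forall>x\<in>set l. 0 < x" for l :: "nat list"
    using that by (induction l) auto
  then show "{l. strict_partition l \<and> P l \<and> psize l = n} \<subseteq> {l. set l \<subseteq> {..n} \<and> length l \<le> n}"
    by (auto simp: strict_partition_def psize_def member_le_sum_list)
  show "finite {l. set l \<subseteq> {..n} \<and> length l \<le> n}"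
    by (rule finite_lists_length_le) simp
qed

section \<open>Hook products and transition weights\<close>

lemma shifted_diagram_Cons:
  "shifted_diagram (x # l) = Pair 1 ` Suc ` {1..x} \<union> map_prod Suc Suc ` shifted_diagram l"
proof (rule set_eqI)
  fix b :: "nat \<times> nat"
  obtain i j where b: "b = (i, j)" by (cases b)
  show "b \<in> shifted_diagram (x # l) \<longleftrightarrow> b \<in> Pair 1 ` Suc ` {1..x} \<union> map_prod Suc Suc ` shifted_diagram l"
  proof (cases i)
    case 0 then show ?thesis by (auto simp: b mem_shifted_diagram)
  next
    case (Suc i')
    show ?thesis
    proof (cases j)
      case 0 then show ?thesis by (auto simp: b mem_shifted_diagram)
    next
      case (Suc j')
      have "b \<in> map_prod Suc Suc ` shifted_diagram l \<longleftrightarrow> (i', j') \<in> shifted_diagram l"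
        by (force simp: b \<open>i = Suc i'\<close> Suc)
      then show ?thesis
        by (cases i') (auto simp: b \<open>i = Suc i'\<close> Suc mem_shifted_diagram part_Suc image_iff)
    qed
  qed
qed

lemma hook_eq:
  assumes "(i, j) \<in> shifted_diagram l"
  shows "hook l (i, j) = i + part l i - j + card {i'. i < i' \<and> (i', j) \<in> shifted_diagram l} + 1 + part l j"
proof -
  have "{(i', j') \<in> shifted_diagram l. i' = i \<and> j' > j} = Pair i ` {j<..i + part l i}"
    using assms by (auto simp: mem_shifted_diagram)
  moreover have "{(i', j') \<in> shifted_diagram l. j' = j \<and> i' > i} = (\<lambda>i'. (i', j)) ` {i'. i < i' \<and> (i', j) \<in> shifted_diagram l}"
    by auto
  ultimately show ?thesis by (simp add: hook_def card_image inj_on_def)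
qed

text \<open>Prepending a row moves the rest by (1, 1). The extra summand \<open>part l j\<close> of
  the hook length survives because its index moves along with the column.\<close>

lemma hook_Cons_Suc:
  assumes "(i, j) \<in> shifted_diagram l"
  shows "hook (x # l) (Suc i, Suc j) = hook l (i, j)"
proof -
  have ij: "1 \<le> i" "i < j" using assms by (auto simp: mem_shifted_diagram)
  have m: "(Suc i', Suc j) \<in> shifted_diagram (x # l) \<longleftrightarrow> (i', j) \<in> shifted_diagram l" if "1 \<le> i'" for i'
    using that by (cases i') (auto simp: mem_shifted_diagram part_Suc)
  have "{i'. Suc i < i' \<and> (i', Suc j) \<in> shifted_diagram (x # l)} = Suc ` {i'. i < i' \<and> (i', j) \<in> shifted_diagram l}"
  proof (rule set_eqI)
    fix k show "k \<in> {i'. Suc i < i' \<and> (i', Suc j) \<in> shifted_diagram (x # l)} \<longleftrightarrow> k \<in> Suc ` {i'. i < i' \<and> (i', j) \<in> shifted_diagram l}"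
      using m[of "k - 1"] by (cases k) auto
  qed
  moreover have "part (x # l) (Suc k) = part l k" if "1 \<le> k" for k
    using that by (cases k) (auto simp: part_Suc)
  ultimately show ?thesis
    using m[OF ij(1)] assms ij by (simp add: hook_eq card_image)
qed

lemma hook_first_row:
  assumes "k \<in> {1..x}"
  shows "hook (x # l) (1, Suc k) = x - k + card {i. (i, k) \<in> shifted_diagram l} + 1 + part l k"
proof -
  have m: "(Suc i', Suc k) \<in> shifted_diagram (x # l) \<longleftrightarrow> (i', k) \<in> shifted_diagram l" if "1 \<le> i'" for i'
    using that by (cases i') (auto simp: mem_shifted_diagram part_Suc)
  have "{i'. 1 < i' \<and> (i', Suc k) \<in> shifted_diagram (x # l)} = Suc ` {i. (i, k) \<in> shifted_diagram l}"
  proof (rule set_eqI)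
    fix i show "i \<in> {i'. 1 < i' \<and> (i', Suc k) \<in> shifted_diagram (x # l)} \<longleftrightarrow> i \<in> Suc ` {i. (i, k) \<in> shifted_diagram l}"
      using m[of "i - 1"] by (cases i) (auto simp: mem_shifted_diagram)
  qed
  moreover have "part (x # l) (Suc k) = part l k" "part (x # l) 1 = x"
    using assms by (cases k) (auto simp: part_def)
  moreover have "(1, Suc k) \<in> shifted_diagram (x # l)"
    using assms by (auto simp: mem_shifted_diagram part_def)
  ultimately show ?thesis
    by (simp add: hook_eq card_image)
qed

text \<open>The hook lengths of the first row together with the differences \<open>x - w\<close> for the remaining
  parts \<open>w\<close> are the numbers \<open>1, \<dots>, x\<close> and the sums \<open>x + w\<close>.\<close>

lemma prod_hook_first_row:
  assumes "strict_partition (x # l)"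
  shows "(\<Prod>k\<in>{1..x}. hook (x # l) (1, Suc k)) * (\<Prod>w\<in>set l. x - w) = fact x * (\<Prod>w\<in>set l. x + w)"
proof -
  have l: "strict_partition l" and lx: "\<forall>w\<in>set l. w < x"
    using assms by (auto simp: strict_partition_def)
  have dl: "distinct l" by (rule strict_partition_distinct[OF l])
  let ?L = "length l"
  define A where "A k = {i. (i, k) \<in> shifted_diagram l}" for k
  define h where "h k = hook (x # l) (1, Suc k)" for k
  have A_sub: "A k \<subseteq> {1..?L}" for k by (auto simp: A_def shifted_diagram_def)
  have finA: "finite (A k)" for k by (rule finite_subset[OF A_sub]) simp
  have cA: "card (A k) \<le> ?L" for k using card_mono[OF _ A_sub[of k]] by simp
  have h: "h k = x - k + card (A k) + 1 + part l k" if "k \<in> {1..x}" for k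
    using hook_first_row[OF that] by (simp add: h_def A_def)
  have "set l \<subseteq> {1..<x}" using lx l by (auto simp: strict_partition_def Suc_le_eq)
  then have Lx: "?L \<le> x" using card_mono[of "{1..<x}" "set l"] distinct_card[OF dl] by simp
  \<comment> \<open>All rows above row k reach column k, so k - 1 boxes lie below in the column, and
    the position k cancels from the hook length.\<close>
  have h_low: "h k = x + part l k" if k: "k \<in> {1..?L}" for k
  proof -
    have "A k = {1..<k}"
    proof
      show "{1..<k} \<subseteq> A k"
      proof
        fix i assume "i \<in> {1..<k}"
        then show "i \<in> A k"
          using part_add_index_antimono[OF l, of i k] k by (auto simp: A_def mem_shifted_diagram)
      qed
    qed (auto simp: A_def mem_shifted_diagram)
    then show ?thesis using h[of k] k Lx by simp
  qed
  have A_mem: "i \<in> A k \<longleftrightarrow> k \<le> i + part l i" if "1 \<le> i" "i \<le> ?L" "?L < k" for i k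
    using that by (auto simp: A_def mem_shifted_diagram)
  \<comment> \<open>Beyond the rows of l the hook length is x - \<open>v k\<close>. It turns out
    that \<open>v\<close> enumerates exactly the numbers below x that are not parts of l.\<close>
  define v where "v k = k - 1 - card (A k)" for k
  have h_high: "h k = x - v k" if k: "k \<in> {?L<..x}" for k
  proof -
    have "part l k = 0" using k by (simp add: part_def)
    then have hk: "h k = x - k + card (A k) + 1" using h[of k] k by simp
    have "?L < k" "k \<le> x" using k by auto
    then show ?thesis unfolding hk v_def using cA[of k] by arith
  qed
  \<comment> \<open>The rows reaching column k form an initial segment. If row i had length
    \<open>v k\<close>, then reaching column k would force \<open>i <= card (A k)\<close> and so i +
    \<open>v k\<close> < k, while not reaching it would force \<open>card (A k) < i\<close> and so i
    + \<open>v k\<close> >= k. Both are absurd.\<close>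
  have v_notin: "v k \<notin> set l" if k: "?L < k" for k
  proof
    assume "v k \<in> set l"
    then have "\<exists>i. 1 \<le> i \<and> i \<le> ?L \<and> part l i = v k" by (rule iffD1[OF mem_set_part_iff])
    then obtain i where i: "1 \<le> i" "i \<le> ?L" "part l i = v k" by blast
    have c: "card (A k) \<le> k - 1" using cA[of k] k by simp
    show False
    proof (cases "i \<in> A k")
      case True
      have "{1..i} \<subseteq> A k"
      proof
        fix i' assume i': "i' \<in> {1..i}"
        then have "part l i + i \<le> part l i' + i'"
          using part_add_index_antimono[OF l, of i' i] i by simp
        then show "i' \<in> A k" using True i i' k by (simp add: A_mem)
      qed
      then have "i \<le> card (A k)" using card_mono[OF finA, of "{1..i}"] by simp
      moreover have "k \<le> i + v k" using True A_mem[of i k] i k by simp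
      ultimately show False using c k by (simp add: v_def)
    next
      case False
      have "A k \<subseteq> {1..<i}"
      proof
        fix i' assume i': "i' \<in> A k"
        then have r: "1 \<le> i'" "i' \<le> ?L" using subsetD[OF A_sub] by fastforce+
        show "i' \<in> {1..<i}"
        proof (rule ccontr)
          assume "i' \<notin> {1..<i}"
          then have "part l i' + i' \<le> part l i + i"
            using part_add_index_antimono[OF l, of i i'] i r by simp
          then show False using False i' i r k by (simp add: A_mem)
        qed
      qed
      then have "card (A k) \<le> i - 1" using card_mono[of "{1..<i}" "A k"] by simp
      moreover have "\<not> k \<le> i + v k" using False A_mem[of i k] i k by simp
      ultimately show False using c k i by (simp add: v_def)
    qed
  qed
  have "strict_mono_on {?L<..x} v"
  proof (rule strict_mono_onI)
    fix k k' assume k: "k \<in> {?L<..x}" "k' \<in> {?L<..x}" "k < k'"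
    have "A k' \<subseteq> A k"
    proof
      fix i assume "i \<in> A k'"
      moreover from this have "1 \<le> i" "i \<le> ?L" using subsetD[OF A_sub] by fastforce+
      ultimately show "i \<in> A k" using k by (simp add: A_mem)
    qed
    then have "card (A k') \<le> card (A k)" using card_mono[OF finA] by blast
    then show "v k < v k'" using k cA[of k] by (simp add: v_def)
  qed
  then have inj: "inj_on v {?L<..x}" by (rule strict_mono_on_imp_inj_on)
  \<comment> \<open>One inclusion suffices, as both sets have x - \<open>?L\<close>
    elements.\<close>
  have img: "v ` {?L<..x} = {..<x} - set l"
  proof (rule card_subset_eq)
    show "v ` {?L<..x} \<subseteq> {..<x} - set l" using v_notin by (auto simp: v_def)
    have "card ({..<x} - set l) = x - ?L"
      using lx by (subst card_Diff_subset) (auto simp: distinct_card[OF dl])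
    then show "card (v ` {?L<..x}) = card ({..<x} - set l)" by (simp add: card_image[OF inj])
  qed simp
  have high: "(\<Prod>k\<in>{?L<..x}. h k) = (\<Prod>w\<in>{..<x} - set l. x - w)"
    by (simp add: img[symmetric] prod.reindex[OF inj] h_high)
  have low: "(\<Prod>k\<in>{1..?L}. h k) = (\<Prod>w\<in>set l. x + w)"
  proof -
    have "inj_on (part l) {1..?L}"
      using part_inject[OF l] part_pos_iff[OF l] by (auto intro!: inj_onI)
    moreover have "part l ` {1..?L} = set l" by (auto simp: mem_set_part_iff)
    ultimately show ?thesis by (simp add: h_low prod.reindex flip: \<open>part l ` {1..?L} = set l\<close>)
  qed
  have split: "(\<Prod>k\<in>{1..x}. h k) = (\<Prod>k\<in>{1..?L}. h k) * (\<Prod>k\<in>{?L<..x}. h k)"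
    using Lx by (subst prod.union_disjoint[symmetric]) (auto intro!: prod.cong)
  have union: "(\<Prod>w\<in>{..<x} - set l. x - w) * (\<Prod>w\<in>set l. x - w) = (\<Prod>w\<in>{..<x}. x - w)"
    using lx by (subst prod.union_disjoint[symmetric]) (auto intro!: prod.cong)
  have fact: "(\<Prod>w\<in>{..<x}. x - w) = fact x"
    by (simp add: fact_prod_rev lessThan_atLeast0)
  have "(\<Prod>k\<in>{1..x}. h k) * (\<Prod>w\<in>set l. x - w) = (\<Prod>w\<in>set l. x + w) * fact x"
    by (simp only: split high low mult.assoc union fact)
  then show ?thesis by (simp only: h_def mult.commute)
qed

text \<open>The classical product formula for the shifted hook product. It depends only on the set
  of parts, so a part can be exchanged without tracking its position.\<close>

definition hook_set :: "nat set \<Rightarrow> real" where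
  "hook_set S = (\<Prod>a\<in>S. fact a) * (\<Prod>(a, b)\<in>{(a, b) \<in> S \<times> S. a < b}. (real a + real b) / (real b - real a))"

text \<open>The absolute value makes each factor positive whether x is the larger or the smaller
  part of the pair.\<close>

lemma hook_set_insert:
  assumes "finite S" "x \<notin> S"
  shows "hook_set (insert x S) = hook_set S * fact x * (\<Prod>b\<in>S. (real x + real b) / \<bar>real x - real b\<bar>)"
proof -
  let ?f = "\<lambda>(a, b). (real a + real b) / (real b - real a)"
  let ?g = "\<lambda>b. (real x + real b) / \<bar>real x - real b\<bar>"
  let ?P = "{(a, b) \<in> S \<times> S. a < b}"
  have fin: "finite ?P" by (rule finite_subset[of _ "S \<times> S"]) (use assms in auto)
  have "{(a, b) \<in> insert x S \<times> insert x S. a < b} = ?P \<union> ((\<lambda>a. (a, x)) ` {a\<in>S. a < x} \<union> Pair x ` {b\<in>S. x < b})"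
    by auto
  moreover have "prod ?f (?P \<union> ((\<lambda>a. (a, x)) ` {a\<in>S. a < x} \<union> Pair x ` {b\<in>S. x < b}))
      = prod ?f ?P * (prod ?f ((\<lambda>a. (a, x)) ` {a\<in>S. a < x}) * prod ?f (Pair x ` {b\<in>S. x < b}))"
    using assms fin by (subst prod.union_disjoint, simp, simp, force, subst prod.union_disjoint) auto
  moreover have "prod ?f ((\<lambda>a. (a, x)) ` {a\<in>S. a < x}) = prod ?g {a\<in>S. a < x}"
    by (subst prod.reindex) (auto simp: inj_on_def add.commute intro!: prod.cong)
  moreover have "prod ?f (Pair x ` {b\<in>S. x < b}) = prod ?g {b\<in>S. x < b}"
    by (subst prod.reindex) (auto simp: inj_on_def intro!: prod.cong)
  moreover have "prod ?g {a\<in>S. a < x} * prod ?g {b\<in>S. x < b} = prod ?g S"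
  proof -
    have "S = {a\<in>S. a < x} \<union> {b\<in>S. x < b}" using assms(2) by (auto, metis linorder_neqE_nat)
    then show ?thesis
      using assms(1) prod.union_disjoint[of "{a\<in>S. a < x}" "{b\<in>S. x < b}" ?g] by fastforce
  qed
  ultimately show ?thesis using assms by (simp add: hook_set_def mult_ac)
qed

lemma hook_set_pos:
  assumes "0 \<notin> S" shows "hook_set S > 0"
  unfolding hook_set_def using assms by (auto intro!: mult_pos_pos prod_pos divide_pos_pos add_nonneg_pos simp: Ball_def)

lemma hook_product_eq_hook_set:
  "strict_partition l \<Longrightarrow> real (hook_product l) = hook_set (set l)"
proof (induction l)
  case Nil
  have "shifted_diagram [] = {}" by (auto simp: shifted_diagram_def)
  then show ?case by (simp add: hook_product_def hook_set_def)
next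
  case (Cons x l)
  have l: "strict_partition l" and lx: "\<forall>w\<in>set l. w < x"
    using Cons.prems by (auto simp: strict_partition_def)
  have "hook_product (x # l) = (\<Prod>b\<in>Pair 1 ` Suc ` {1..x}. hook (x # l) b) * (\<Prod>b\<in>map_prod Suc Suc ` shifted_diagram l. hook (x # l) b)"
    unfolding hook_product_def shifted_diagram_Cons
    by (rule prod.union_disjoint) (auto simp: mem_shifted_diagram)
  also have "(\<Prod>b\<in>map_prod Suc Suc ` shifted_diagram l. hook (x # l) b) = hook_product l"
    unfolding hook_product_def
    by (subst prod.reindex) (auto simp: inj_on_def hook_Cons_Suc intro!: prod.cong)
  also have "(\<Prod>b\<in>Pair 1 ` Suc ` {1..x}. hook (x # l) b) = (\<Prod>k\<in>{1..x}. hook (x # l) (1, Suc k))"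
    by (subst prod.reindex, simp add: inj_on_def, subst prod.reindex) auto
  finally have hp: "hook_product (x # l) = (\<Prod>k\<in>{1..x}. hook (x # l) (1, Suc k)) * hook_product l" .
  have "real (\<Prod>k\<in>{1..x}. hook (x # l) (1, Suc k)) * real (\<Prod>w\<in>set l. x - w) = real (fact x * (\<Prod>w\<in>set l. x + w))"
    by (simp only: prod_hook_first_row[OF Cons.prems] flip: of_nat_mult)
  moreover have "real (\<Prod>w\<in>set l. x - w) = (\<Prod>w\<in>set l. \<bar>real x - real w\<bar>)"
    unfolding of_nat_prod by (intro prod.cong refl) (use lx in \<open>auto simp: of_nat_diff less_imp_le\<close>)
  moreover have "(\<Prod>w\<in>set l. \<bar>real x - real w\<bar>) \<noteq> 0" using lx by auto
  ultimately have "real (\<Prod>k\<in>{1..x}. hook (x # l) (1, Suc k)) = fact x * (\<Prod>b\<in>set l. (real x + real b) / \<bar>real x - real b\<bar>)"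
    by (simp add: prod_dividef field_simps)
  then show ?case
    using Cons.IH[OF l] hook_set_insert[of "set l" x] lx by (auto simp: hp mult_ac)
qed

section \<open>Transition weights between a partition and its covers\<close>

definition tri_up :: "nat \<Rightarrow> real" where "tri_up b = real b * (real b + 1) / 2"
definition tri_down :: "nat \<Rightarrow> real" where "tri_down b = real b * (real b - 1) / 2"

text \<open>Here \<open>tri_up a\<close> is the value of the box that extends a row of length a, and
  \<open>tri_down b\<close> that of the last box in a row of length b. For a strict partition, 0 is
  one node more than there are zeros, as interpolation requires.\<close>

definition transition :: "nat list \<Rightarrow> nat \<Rightarrow> real" where
  "transition l = interp_weight tri_up tri_down (set l) (insert 0 (set l))"

text \<open>Only the factors of \<open>Pfun\<close> that depend on l; the powers of 2 coming from
  the inner partition are constant.\<close>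

definition plancherel_weight :: "nat list \<Rightarrow> real" where
  "plancherel_weight l = 2 ^ psize l / 2 ^ length l / real (hook_product l)"

lemma transition_eq_0:
  assumes "a \<in> insert 0 (set l)" "Suc a \<in> set l"
  shows "transition l a = 0"
proof -
  have "tri_up a - tri_down (Suc a) = 0" by (simp add: tri_up_def tri_down_def algebra_simps)
  then have "(\<Prod>b\<in>set l. tri_up a - tri_down b) = 0" using assms by (intro prod_zero) auto
  then show ?thesis by (simp add: transition_def interp_weight_def)
qed

text \<open>Apart from a constant, the quotient of the two product formulas is a product over the
  common parts S, and this matches the Lagrange weight factor by factor.\<close>

lemma plancherel_weight_raise:
  assumes l: "strict_partition l" and a: "a \<in> insert 0 (set l)" and Suca: "Suc a \<notin> set l"
  shows "plancherel_weight (raise l a) = plancherel_weight l * transition l a"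
proof -
  define S where "S = set l - {a}"
  have S: "finite S" "a \<notin> S" "Suc a \<notin> S" "0 \<notin> S" using Suca l by (auto simp: S_def strict_partition_def)
  \<comment> \<open>The size contributes 2, which the additional part cancels if a = 0; the
    factorials contribute 1 / (a + 1).\<close>
  define c :: real where "c = (if a = 0 then 1 else 2) / (real a + 1)"
  let ?P = "\<lambda>x. \<Prod>b\<in>S. (real x + real b) / \<bar>real x - real b\<bar>"
  have Ppos: "?P x > 0" if "x \<notin> S" for x
  proof (rule prod_pos)
    fix b assume "b \<in> S"
    then have "b \<noteq> 0" "b \<noteq> x" using that S(4) by metis+
    then show "(real x + real b) / \<bar>real x - real b\<bar> > 0" by (intro divide_pos_pos) auto
  qed
  have hS: "hook_set S > 0" using S(4) by (rule hook_set_pos)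
  \<comment> \<open>The node 0 is not a part, but its factorial and all its quotients equal 1. One
    formula thus covers the appending of a new part.\<close>
  have h1: "hook_set (set l) = hook_set S * fact a * ?P a"
  proof (cases "a = 0")
    case True
    then have "set l = S" using l by (auto simp: S_def strict_partition_def)
    moreover have "?P a = 1"
    proof (intro prod.neutral ballI)
      fix b assume "b \<in> S"
      then have "b \<noteq> 0" using S(4) by metis
      then show "(real a + real b) / \<bar>real a - real b\<bar> = 1" using True by simp
    qed
    ultimately show ?thesis using True by simp
  next
    case False
    then have "set l = insert a S" using a by (auto simp: S_def)
    then show ?thesis using hook_set_insert[OF S(1,2)] by simp
  qed
  have h2: "hook_set (set (raise l a)) = hook_set S * fact (Suc a) * ?P (Suc a)"
    using hook_set_insert[OF S(1,3)] set_raise[OF l a] by (simp add: S_def)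
  have sr: "strict_partition (raise l a)" by (rule strict_partition_raise[OF l Suca])
  have ps: "psize (raise l a) = Suc (psize l)" by (rule psize_covers[OF covers_raise[OF l a Suca]])
  have "plancherel_weight (raise l a) = 2 ^ Suc (psize l) / 2 ^ length (raise l a) / (hook_set S * fact (Suc a) * ?P (Suc a))"
    unfolding plancherel_weight_def ps hook_product_eq_hook_set[OF sr] h2 ..
  also have "\<dots> = 2 ^ psize l / 2 ^ length l / (hook_set S * fact a * ?P a) * (c * (?P a / ?P (Suc a)))"
    using hS Ppos[OF S(2)] Ppos[OF S(3)] by (simp add: c_def length_raise field_simps)
  \<comment> \<open>Both differences of triangular numbers factor, see \<open>e1\<close> and
    \<open>e2\<close>. As b is neither a nor a + 1, the differences a - b and a + 1 - b have the
    same sign, so the absolute values cancel.\<close>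
  also have "?P a / ?P (Suc a) = (\<Prod>b\<in>S. (tri_up a - tri_down b) / (tri_up a - tri_up b))"
    unfolding prod_dividef[symmetric]
  proof (intro prod.cong refl)
    fix b assume b: "b \<in> S"
    then have b0: "b \<noteq> 0" "b \<noteq> a" "b \<noteq> Suc a" using S by metis+
    have e1: "tri_up a - tri_down b = (real a + real b) * (real a + 1 - real b) / 2"
      and e2: "tri_up a - tri_up b = (real a - real b) * (real a + 1 + real b) / 2"
      by (simp_all add: tri_up_def tri_down_def field_simps)
    show "(real a + real b) / \<bar>real a - real b\<bar> / ((real (Suc a) + real b) / \<bar>real (Suc a) - real b\<bar>)
        = (tri_up a - tri_down b) / (tri_up a - tri_up b)"
    proof (cases "b < a")
      case True
      then have "\<bar>real a - real b\<bar> = real a - real b" "\<bar>real (Suc a) - real b\<bar> = real a + 1 - real b"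
        "real (Suc a) + real b = real a + 1 + real b"
        by auto
      then show ?thesis by (simp only: e1 e2) simp
    next
      case False
      then have "b > Suc a" using b0 by simp
      then have "\<bar>real a - real b\<bar> = - (real a - real b)" "\<bar>real (Suc a) - real b\<bar> = - (real a + 1 - real b)"
        "real (Suc a) + real b = real a + 1 + real b"
        by auto
      moreover have "p / - q / (r / - s) = (p * s / 2) / (q * r / 2)" for p q r s :: real by simp
      ultimately show ?thesis by (simp only: e1 e2)
    qed
  qed
  also have "c * \<dots> = transition l a"
  proof (cases "a = 0")
    case True
    then have "set l = S" using l by (auto simp: S_def strict_partition_def)
    then show ?thesis using True S by (simp add: transition_def interp_weight_def c_def prod_dividef)
  next
    case False
    \<comment> \<open>For a > 0 the zero \<open>tri_down a\<close> and the node 0 are left over;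
      together they give a / (a (a + 1) / 2) = 2 / (a + 1).\<close>
    then have "set l = insert a S" and T: "insert 0 (set l) - {a} = insert 0 S" using a by (auto simp: S_def)
    then have "transition l a = (tri_up a - tri_down a) / (tri_up a - tri_up 0) *
       (\<Prod>b\<in>S. (tri_up a - tri_down b) / (tri_up a - tri_up b))"
      using S by (simp add: transition_def interp_weight_def prod_dividef)
    also have "(tri_up a - tri_down a) / (tri_up a - tri_up 0) = c"
    proof -
      have "tri_up a - tri_down a = real a" "tri_up a - tri_up 0 = real a * (real a + 1) / 2"
        by (simp_all add: tri_up_def tri_down_def field_simps)
      then have "(tri_up a - tri_down a) / (tri_up a - tri_up 0) = real a / (real a * (real a + 1) / 2)"
        by (simp only:)
      then show ?thesis using False by (simp only: c_def) simp
    qed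
    finally show ?thesis by simp
  qed
  finally show ?thesis
    unfolding plancherel_weight_def hook_product_eq_hook_set[OF l] h1 .
qed

section \<open>Standard fillings\<close>

text \<open>The condition of \<open>num_syt\<close> for an arbitrary set of boxes, so that a box can
  be deleted before the rest is known to be a skew diagram.\<close>

definition standard_fillings :: "(nat \<times> nat) set \<Rightarrow> (nat \<times> nat \<Rightarrow> nat) set" where
  "standard_fillings X = {T :: nat \<times> nat \<Rightarrow> nat.
      bij_betw T X {1..card X}
    \<and> (\<forall>b. b \<notin> X \<longrightarrow> T b = 0)
    \<and> (\<forall>i j j'. (i, j) \<in> X \<and> (i, j') \<in> X \<and> j < j' \<longrightarrow> T (i, j) < T (i, j'))
    \<and> (\<forall>i i' j. (i, j) \<in> X \<and> (i', j) \<in> X \<and> i < i' \<longrightarrow> T (i, j) < T (i', j))}"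

lemma num_syt_eq: "num_syt l m = card (standard_fillings (skew_diagram l m))"
  by (simp add: num_syt_def standard_fillings_def)

definition corners :: "(nat \<times> nat) set \<Rightarrow> (nat \<times> nat) set" where
  "corners X = {(i, j) \<in> X. (\<forall>j'. j < j' \<longrightarrow> (i, j') \<notin> X) \<and> (\<forall>i'. i < i' \<longrightarrow> (i', j) \<notin> X)}"

lemma standard_fillings_row:
  "T \<in> standard_fillings X \<Longrightarrow> (i, j) \<in> X \<Longrightarrow> (i, j') \<in> X \<Longrightarrow> j < j' \<Longrightarrow> T (i, j) < T (i, j')"
  unfolding standard_fillings_def by blast

lemma standard_fillings_column:
  "T \<in> standard_fillings X \<Longrightarrow> (i, j) \<in> X \<Longrightarrow> (i', j) \<in> X \<Longrightarrow> i < i' \<Longrightarrow> T (i, j) < T (i', j)"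
  unfolding standard_fillings_def by blast

lemma standard_fillings_outside: "T \<in> standard_fillings X \<Longrightarrow> b \<notin> X \<Longrightarrow> T b = 0"
  unfolding standard_fillings_def by blast

lemma finite_standard_fillings:
  assumes "finite X" shows "finite (standard_fillings X)"
proof (rule finite_subset)
  show "standard_fillings X \<subseteq> {T. \<forall>b. (b \<in> X \<longrightarrow> T b \<in> {1..card X}) \<and> (b \<notin> X \<longrightarrow> T b = 0)}"
    by (auto simp: standard_fillings_def dest: bij_betwE)
  show "finite {T. \<forall>b. (b \<in> X \<longrightarrow> T b \<in> {1..card X}) \<and> (b \<notin> X \<longrightarrow> T b = (0::nat))}"
    using assms by (rule finite_set_of_finite_funs) simp
qed

lemma standard_fillings_add_max:
  assumes X: "finite X" and b: "b \<in> corners X" and T: "T \<in> standard_fillings (X - {b})"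
  shows "T(b := card X) \<in> standard_fillings X"
proof -
  let ?T = "T(b := card X)"
  have bX: "b \<in> X" using b by (auto simp: corners_def)
  have c: "card X = Suc (card (X - {b}))" using card_Suc_Diff1[OF X bX] by simp
  have T_bij: "bij_betw T (X - {b}) {1..card (X - {b})}" using T by (simp add: standard_fillings_def)
  have less: "T x < card X" if "x \<in> X" "x \<noteq> b" for x
  proof -
    have "T x \<in> {1..card (X - {b})}" using bij_betwE[OF T_bij] that by blast
    then show ?thesis using c by simp
  qed
  have "bij_betw ?T (X - {b}) {1..card (X - {b})}"
    using T_bij by (rule bij_betw_cong[THEN iffD1, rotated]) simp
  then have "bij_betw ?T (insert b (X - {b})) (insert (?T b) {1..card (X - {b})})"
    using notIn_Un_bij_betw[of b "X - {b}" ?T "{1..card (X - {b})}"] by (simp add: c)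
  moreover have "insert b (X - {b}) = X" "insert (?T b) {1..card (X - {b})} = {1..card X}"
    using bX c by auto
  ultimately have "bij_betw ?T X {1..card X}" by simp
  moreover have "\<forall>x. x \<notin> X \<longrightarrow> ?T x = 0"
    using T bX by (auto simp: standard_fillings_def)
  moreover have "?T (i, j) < ?T (i, j')" if "(i, j) \<in> X" "(i, j') \<in> X" "j < j'" for i j j'
  proof -
    have "(i, j) \<noteq> b" using that b by (auto simp: corners_def)
    then show ?thesis
      using that less[of "(i, j)"] standard_fillings_row[OF T, of i j j'] by (cases "(i, j') = b") auto
  qed
  moreover have "?T (i, j) < ?T (i', j)" if "(i, j) \<in> X" "(i', j) \<in> X" "i < i'" for i i' j
  proof -
    have "(i, j) \<noteq> b" using that b by (auto simp: corners_def)
    then show ?thesis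
      using that less[of "(i, j)"] standard_fillings_column[OF T, of i j i'] by (cases "(i', j) = b") auto
  qed
  ultimately show ?thesis by (simp add: standard_fillings_def)
qed

lemma standard_fillings_remove_max:
  assumes X: "finite X" "X \<noteq> {}" and T: "T \<in> standard_fillings X"
  obtains b where "b \<in> corners X" "T b = card X" "T(b := 0) \<in> standard_fillings (X - {b})"
proof -
  have T_bij: "bij_betw T X {1..card X}" using T by (simp add: standard_fillings_def)
  have "card X \<in> {1..card X}" using X by (simp add: Suc_le_eq card_gt_0_iff)
  then have "card X \<in> T ` X" using bij_betw_imp_surj_on[OF T_bij] by simp
  then obtain b where b: "b \<in> X" "T b = card X" by (metis imageE)
  have le: "T x \<le> card X" if "x \<in> X" for x using bij_betwE[OF T_bij] that by auto
  obtain i j where ij: "b = (i, j)" by (cases b)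
  have corner: "b \<in> corners X"
    unfolding corners_def ij
  proof safe
    show "(i, j) \<in> X" using b ij by simp
    fix j' assume j': "j < j'" "(i, j') \<in> X"
    then have "T b < T (i, j')" using standard_fillings_row[OF T] b(1) unfolding ij by blast
    then show False using le[OF j'(2)] b by simp
  next
    fix i' assume i': "i < i'" "(i', j) \<in> X"
    then have "T b < T (i', j)" using standard_fillings_column[OF T] b(1) unfolding ij by blast
    then show False using le[OF i'(2)] b by simp
  qed
  have c: "card X = Suc (card (X - {b}))" using card_Suc_Diff1[OF X(1) b(1)] by simp
  have "bij_betw T (X - {b}) ({1..card X} - {T b})"
    using T_bij b(1) by (intro bij_betw_DiffI) (auto simp: bij_betw_def)
  moreover have "{1..card X} - {T b} = {1..card (X - {b})}" unfolding b(2) c by auto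
  ultimately have "bij_betw T (X - {b}) {1..card (X - {b})}" by simp
  then have "bij_betw (T(b := 0)) (X - {b}) {1..card (X - {b})}"
    by (rule bij_betw_cong[THEN iffD1, rotated]) simp
  then have "T(b := 0) \<in> standard_fillings (X - {b})"
    using T by (auto simp: standard_fillings_def)
  then show ?thesis using that corner b(2) by blast
qed

text \<open>Fillings are sorted by the position of their largest entry, which has to be a
  corner.\<close>

lemma card_standard_fillings:
  assumes X: "finite X" "X \<noteq> {}"
  shows "card (standard_fillings X) = (\<Sum>b\<in>corners X. card (standard_fillings (X - {b})))"
proof -
  let ?F = "\<lambda>b. (\<lambda>T. T(b := card X)) ` standard_fillings (X - {b})"
  have fin: "finite (corners X)" by (rule finite_subset[OF _ X(1)]) (auto simp: corners_def)
  have "standard_fillings X = (\<Union>b\<in>corners X. ?F b)"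
  proof
    show "standard_fillings X \<subseteq> (\<Union>b\<in>corners X. ?F b)"
    proof
      fix T assume "T \<in> standard_fillings X"
      then obtain b where b: "b \<in> corners X" "T b = card X" "T(b := 0) \<in> standard_fillings (X - {b})"
        using standard_fillings_remove_max[OF X] by blast
      moreover have "T = (T(b := 0))(b := card X)" using b(2) by auto
      ultimately show "T \<in> (\<Union>b\<in>corners X. ?F b)" by blast
    qed
  qed (use standard_fillings_add_max[OF X(1)] in auto)
  moreover have "card (\<Union>b\<in>corners X. ?F b) = (\<Sum>b\<in>corners X. card (?F b))"
  proof (rule card_UN_disjoint[OF fin])
    show "\<forall>b\<in>corners X. finite (?F b)" using X finite_standard_fillings by auto
    show "\<forall>b\<in>corners X. \<forall>b'\<in>corners X. b \<noteq> b' \<longrightarrow> ?F b \<inter> ?F b' = {}"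
    \<comment> \<open>A common filling would have the entry \<open>card X\<close> at two boxes,
      against injectivity.\<close>
    proof (intro ballI impI equals0I)
      fix b b' T'' assume bb: "b \<in> corners X" "b' \<in> corners X" "b \<noteq> b'" "T'' \<in> ?F b \<inter> ?F b'"
      then obtain T T' where T: "T \<in> standard_fillings (X - {b})" "T(b := card X) = T'(b' := card X)"
        by blast
      have "T(b := card X) \<in> standard_fillings X" by (rule standard_fillings_add_max[OF X(1) bb(1) T(1)])
      then have "inj_on (T(b := card X)) X" by (simp add: standard_fillings_def bij_betw_def)
      moreover have "(T(b := card X)) b = (T(b := card X)) b'" using T(2) by (metis fun_upd_same)
      moreover have "b \<in> X" "b' \<in> X" using bb(1,2) by (auto simp: corners_def)
      ultimately have "b = b'" by (rule inj_onD)
      then show False using bb(3) by simp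
    qed
  qed
  moreover have "card (?F b) = card (standard_fillings (X - {b}))" for b
  proof (rule card_image, rule inj_onI)
    fix T T' assume T: "T \<in> standard_fillings (X - {b})" "T' \<in> standard_fillings (X - {b})"
      "T(b := card X) = T'(b := card X)"
    then have "T b = T' b" by (simp add: standard_fillings_outside)
    then show "T = T'" using T(3) by (metis fun_upd_triv fun_upd_upd)
  qed
  ultimately show ?thesis by simp
qed

lemma shifted_diagram_left_closed:
  "(i, j') \<in> shifted_diagram l \<Longrightarrow> i < j \<Longrightarrow> j \<le> j' \<Longrightarrow> (i, j) \<in> shifted_diagram l"
  by (auto simp: mem_shifted_diagram)

lemma shifted_diagram_up_closed:
  assumes "strict_partition l" "(i', j) \<in> shifted_diagram l" "1 \<le> i" "i \<le> i'"
  shows "(i, j) \<in> shifted_diagram l"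
proof -
  have i': "i' < j" "j \<le> i' + part l i'" using assms(2) by (auto simp: mem_shifted_diagram)
  then have "i' \<le> length l" using part_pos_iff[OF assms(1), of i'] by simp
  then have "part l i' + i' \<le> part l i + i" using part_add_index_antimono[OF assms(1,3,4)] by simp
  then show ?thesis using assms i' by (auto simp: mem_shifted_diagram)
qed

text \<open>Deleting a corner of the skew diagram leaves the skew diagram of a partition k between m
  and l. The strict inequality of sizes makes sure that there is an entry to delete.\<close>

lemma num_syt_recurrence:
  assumes l: "strict_partition l" and sub: "pcontains l m" and m: "strict_partition m"
    and size: "psize m < psize l"
  shows "num_syt l m = (\<Sum>k\<in>{k. covers k l \<and> pcontains k m}. num_syt k m)"
proof -
  let ?X = "skew_diagram l m" and ?K = "{k. covers k l \<and> pcontains k m}"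
  have sub': "shifted_diagram m \<subseteq> shifted_diagram l" using sub by (simp add: pcontains_iff_subset)
  have X: "finite ?X" by (simp add: skew_diagram_def)
  have ne: "?X \<noteq> {}"
  proof
    assume "?X = {}"
    then have "shifted_diagram l = shifted_diagram m" using sub' by (auto simp: skew_diagram_def)
    then show False using size l m by (simp add: psize_eq_card)
  qed
  define f where "f k = (THE b. b \<in> shifted_diagram l - shifted_diagram k)" for k
  have f: "f k \<notin> shifted_diagram k \<and> shifted_diagram l = insert (f k) (shifted_diagram k)" if k: "covers k l" for k
  proof -
    obtain b where b: "b \<notin> shifted_diagram k" "shifted_diagram l = insert b (shifted_diagram k)"
      using k by (auto simp: covers_def)
    have "f k = b" unfolding f_def by (rule the_equality) (use b in auto)
    then show ?thesis using b by simp
  qed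
  have "(\<Sum>k\<in>?K. card (standard_fillings (?X - {f k}))) = (\<Sum>b\<in>corners ?X. card (standard_fillings (?X - {b})))"
  proof (rule sum.reindex_bij_betw)
    show "bij_betw f ?K (corners ?X)"
      unfolding bij_betw_def
    proof
      show "inj_on f ?K"
      proof (rule inj_onI)
        fix k k' assume k: "k \<in> ?K" "k' \<in> ?K" "f k = f k'"
        have "shifted_diagram k = shifted_diagram l - {f k}" "shifted_diagram k' = shifted_diagram l - {f k'}"
          using f[of k] f[of k'] k by (metis Diff_insert_absorb mem_Collect_eq)+
        then have "shifted_diagram k = shifted_diagram k'" using k(3) by simp
        then show "k = k'"
          using k by (intro strict_partition_eqI shifted_diagram_inject) (auto simp: covers_def)
      qed
      show "f ` ?K = corners ?X"
      proof
        show "f ` ?K \<subseteq> corners ?X"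
        proof
          fix b assume "b \<in> f ` ?K"
          then obtain k where k: "covers k l" "pcontains k m" "b = f k" by auto
          have d: "b \<notin> shifted_diagram k" "shifted_diagram l = insert b (shifted_diagram k)" using f[OF k(1)] k(3) by auto
          have sk: "strict_partition k" using k(1) by (simp add: covers_def)
          obtain i j where ij: "b = (i, j)" by (cases b)
          have "1 \<le> i" "i < j" using d(2) mem_shifted_diagram[of i j l] by (auto simp: ij)
          have "b \<in> ?X" using d k(2) by (auto simp: skew_diagram_def pcontains_iff_subset)
          moreover have "(i, j') \<notin> ?X" if "j < j'" for j'
          proof
            assume "(i, j') \<in> ?X"
            then have "(i, j') \<in> shifted_diagram k" using d that by (auto simp: skew_diagram_def ij)
            then show False using shifted_diagram_left_closed[of i j' k j] d(1) that \<open>i < j\<close> by (simp add: ij)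
          qed
          moreover have "(i', j) \<notin> ?X" if "i < i'" for i'
          proof
            assume "(i', j) \<in> ?X"
            then have "(i', j) \<in> shifted_diagram k" using d that by (auto simp: skew_diagram_def ij)
            then show False using shifted_diagram_up_closed[OF sk, of i' j i] d(1) that \<open>1 \<le> i\<close> by (simp add: ij)
          qed
          ultimately show "b \<in> corners ?X" by (auto simp: corners_def ij)
        qed
        show "corners ?X \<subseteq> f ` ?K"
        proof
          fix b assume b: "b \<in> corners ?X"
          obtain i j where ij: "b = (i, j)" by (cases b)
          have bl: "(i, j) \<in> shifted_diagram l" and bm: "(i, j) \<notin> shifted_diagram m"
            using b by (auto simp: corners_def skew_diagram_def ij)
          have i: "1 \<le> i" "i < j" using bl by (auto simp: mem_shifted_diagram)
          \<comment> \<open>A corner of the skew diagram is a corner of l: if the next box to the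
            right or below lay in m, then (i, j) would lie in m too.\<close>
          have "(i, Suc j) \<notin> shifted_diagram m"
            using shifted_diagram_left_closed[of i "Suc j" m j] bm i by auto
          then have r: "(i, Suc j) \<notin> shifted_diagram l"
            using b by (auto simp: corners_def skew_diagram_def ij)
          have "(Suc i, j) \<notin> shifted_diagram m"
            using shifted_diagram_up_closed[OF m, of "Suc i" j i] bm i by auto
          then have "(Suc i, j) \<notin> shifted_diagram l"
            using b by (auto simp: corners_def skew_diagram_def ij)
          then obtain k where k: "covers k l" "shifted_diagram k = shifted_diagram l - {(i, j)}"
            using covers_remove_corner[OF l bl r] by blast
          then have "k \<in> ?K" using sub' bm by (auto simp: pcontains_iff_subset)
          moreover have "f k = b" using f[OF k(1)] k(2) bl by (auto simp: ij)
          ultimately show "b \<in> f ` ?K" by blast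
        qed
      qed
    qed
  qed
  moreover have "?X - {f k} = skew_diagram k m" if "k \<in> ?K" for k
    using f[of k] that by (auto simp: skew_diagram_def pcontains_iff_subset)
  ultimately show ?thesis
    by (simp add: num_syt_eq card_standard_fillings[OF X ne])
qed

section \<open>Polynomiality\<close>

definition content_psum :: "nat \<Rightarrow> nat list \<Rightarrow> real" where
  "content_psum k l = (\<Sum>b\<in>shifted_diagram l. box_binom b ^ k)"

lemma content_psum_raise:
  assumes "strict_partition l" "a \<in> insert 0 (set l)"
  shows "content_psum k (raise l a) = tri_up a ^ k + content_psum k l"
proof -
  obtain b where "b \<notin> shifted_diagram l" "shifted_diagram (raise l a) = insert b (shifted_diagram l)"
    "box_binom b = tri_up a"
    using shifted_diagram_raise[OF assms] unfolding tri_up_def by blast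
  then show ?thesis by (simp add: content_psum_def)
qed

lemma content_psum_eq:
  assumes "strict_partition l"
  shows "content_psum k l = (\<Sum>x\<in>set l. \<Sum>c\<in>{1..x}. tri_down c ^ k)"
proof -
  have "box_binom b = tri_down (snd b - fst b)" if "b \<in> shifted_diagram l" for b
    using that by (cases b) (auto simp: box_binom_def content_def tri_down_def mem_shifted_diagram)
  then show ?thesis
    unfolding content_psum_def using sum_shifted_diagram[OF assms, of "\<lambda>c. tri_down c ^ k"] by simp
qed

text \<open>With \<open>x = c (c - 1) / 2\<close>, the numbers \<open>x + c\<close> and \<open>x + 1 - c\<close> are the roots of
  \<open>t\<^sup>2 - (2 x + 1) t + (x\<^sup>2 - x)\<close>; this gives the recursion.\<close>

fun second_difference :: "nat \<Rightarrow> real poly" where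
  "second_difference 0 = 0"
| "second_difference (Suc 0) = 1"
| "second_difference (Suc (Suc r)) =
     [:1, 2:] * second_difference (Suc r) - [:0, -1, 1:] * second_difference r + monom 4 (Suc r)"

text \<open>For v(c) = c (c - 1) / 2 = x one has x + c = v(c + 1) and x + 1 - c = v(c - 1), so this
  is the second central difference of v^r at c. The summand \<open>monom 4 (Suc r)\<close> corrects
  the recursion for the term - 2 x^r, since x itself is not a root of the quadratic.\<close>

lemma poly_second_difference:
  fixes c x :: real
  assumes "2 * x = c * (c - 1)"
  shows "poly (second_difference r) x = (x + c) ^ r + (x + 1 - c) ^ r - 2 * x ^ r"
proof (induction r rule: second_difference.induct)
  case (3 r)
  have quad: "t ^ Suc (Suc r) = (2 * x + 1) * t ^ Suc r - (x * x - x) * t ^ r"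
    if "t * t = (2 * x + 1) * t - (x * x - x)" for t
  proof -
    have "t ^ Suc (Suc r) = (t * t) * t ^ r" by simp
    then show ?thesis unfolding that by (simp add: algebra_simps)
  qed
  have root: "(x + c) * (x + c) = (2 * x + 1) * (x + c) - (x * x - x)"
    "(x + 1 - c) * (x + 1 - c) = (2 * x + 1) * (x + 1 - c) - (x * x - x)"
    using assms by (simp_all add: algebra_simps)
  have "poly (second_difference (Suc (Suc r))) x =
      (2 * x + 1) * ((x + c) ^ Suc r + (x + 1 - c) ^ Suc r - 2 * x ^ Suc r)
      - (x * x - x) * ((x + c) ^ r + (x + 1 - c) ^ r - 2 * x ^ r) + 4 * x ^ Suc r"
    by (simp only: second_difference.simps poly_add poly_diff poly_mult 3 poly_monom) (simp add: algebra_simps)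
  also have "\<dots> = ((2 * x + 1) * (x + c) ^ Suc r - (x * x - x) * (x + c) ^ r)
      + ((2 * x + 1) * (x + 1 - c) ^ Suc r - (x * x - x) * (x + 1 - c) ^ r) - 2 * x ^ Suc (Suc r)"
    by (simp add: algebra_simps)
  finally show ?case by (simp only: quad[OF root(1)] quad[OF root(2)])
qed auto

text \<open>In c, the second difference lowers the degree 2 r of v^r by 2. The drop to r - 1 in x is
  what gives \<open>node_psum r\<close> weight at most r.\<close>

lemma degree_second_difference: "degree (second_difference r) \<le> r - 1"
proof (induction r rule: second_difference.induct)
  case (3 r)
  have "degree ([:1, 2:] * second_difference (Suc r)) \<le> Suc r"
    using degree_mult_le[of "[:1, 2:]" "second_difference (Suc r)"] 3 by simp
  moreover have "degree ([:0, -1, 1:] * second_difference r) \<le> Suc r"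
    using degree_mult_le[of "[:0, -1, 1:]" "second_difference r"] 3 by (cases r) auto
  moreover have "degree (monom (4::real) (Suc r)) \<le> Suc r" by (rule degree_monom_le)
  ultimately show ?case by (auto intro!: degree_add_le degree_diff_le)
qed auto

definition node_psum :: "nat \<Rightarrow> nat list \<Rightarrow> real" where
  "node_psum r l = (\<Sum>b\<in>insert 0 (set l). tri_up b ^ r) - (\<Sum>b\<in>set l. tri_down b ^ r)"

text \<open>Telescoping: since \<open>tri_up b = tri_down (Suc b)\<close>, the left side is a first
  difference, and it vanishes at b = 0 because v(0) = v(1) = 0.\<close>

lemma tri_power_diff:
  "r \<ge> 1 \<Longrightarrow> tri_up b ^ r - tri_down b ^ r = (\<Sum>c\<in>{1..b}. poly (second_difference r) (tri_down c))"
proof (induction b)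
  case 0
  then show ?case by (simp add: tri_up_def tri_down_def)
next
  case (Suc b)
  have e: "tri_down (Suc b) = tri_up b" "tri_up (Suc b) = tri_up b + real (Suc b)"
    "tri_up b + 1 - real (Suc b) = tri_down b"
    by (simp_all add: tri_up_def tri_down_def field_simps)
  have "poly (second_difference r) (tri_up b) = tri_up (Suc b) ^ r + tri_down b ^ r - 2 * tri_up b ^ r"
    by (subst poly_second_difference[of _ "real (Suc b)"]) (simp add: tri_up_def, simp only: e)
  then show ?case using Suc by (simp add: e)
qed

lemma node_psum_eq:
  assumes l: "strict_partition l" and r: "r \<ge> 1"
  shows "node_psum r l = (\<Sum>j\<le>degree (second_difference r). coeff (second_difference r) j * content_psum j l)"
proof -
  have "0 \<notin> set l" using l by (auto simp: strict_partition_def)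
  then have "node_psum r l = (\<Sum>b\<in>set l. tri_up b ^ r - tri_down b ^ r)"
    using r by (simp add: node_psum_def sum_subtractf tri_up_def)
  also have "\<dots> = (\<Sum>b\<in>set l. \<Sum>c\<in>{1..b}. \<Sum>j\<le>degree (second_difference r). coeff (second_difference r) j * tri_down c ^ j)"
    by (simp only: tri_power_diff[OF r] poly_altdef)
  also have "\<dots> = (\<Sum>j\<le>degree (second_difference r). \<Sum>b\<in>set l. \<Sum>c\<in>{1..b}. coeff (second_difference r) j * tri_down c ^ j)"
    by (subst sum.swap, subst (2) sum.swap) (simp add: sum.swap[of _ _ "{..degree (second_difference r)}"])
  finally show ?thesis by (simp only: content_psum_eq[OF l] sum_distrib_left)
qed

section \<open>Moments and averages for the transition weights\<close>

definition transition_moment :: "nat \<Rightarrow> nat list \<Rightarrow> real" where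
  "transition_moment k l = moment tri_up tri_down (set l) (insert 0 (set l)) k"

lemma inj_tri_up: "inj_on tri_up A"
proof (rule inj_onI)
  fix a b assume "tri_up a = tri_up b"
  then have "(real a - real b) * (real a + real b + 1) = 0" by (simp add: tri_up_def algebra_simps)
  then show "a = b" by (simp add: add_nonneg_eq_0_iff)
qed

lemma
  assumes "strict_partition l"
  shows transition_moment_0: "transition_moment 0 l = 1"
    and transition_moment_newton: "real (Suc k) * transition_moment (Suc k) l =
      (\<Sum>r\<le>k. node_psum (Suc r) l * transition_moment (k - r) l)"
proof -
  have "0 \<notin> set l" using assms by (auto simp: strict_partition_def)
  then have c: "card (insert 0 (set l)) = Suc (card (set l))" by simp
  show "transition_moment 0 l = 1"
    unfolding transition_moment_def by (rule moment_0[OF _ _ inj_tri_up c]) auto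
  show "real (Suc k) * transition_moment (Suc k) l =
      (\<Sum>r\<le>k. node_psum (Suc r) l * transition_moment (k - r) l)"
    unfolding transition_moment_def node_psum_def by (rule moment_newton[OF _ _ inj_tri_up c]) auto
qed

text \<open>The recursion for the sums uses j = 0. Positive j arise from products with a power sum,
  which grows by \<open>tri_up a ^ k\<close> when a is raised.\<close>

definition transition_avg :: "nat \<Rightarrow> (nat list \<Rightarrow> real) \<Rightarrow> nat list \<Rightarrow> real" where
  "transition_avg j F l = (\<Sum>a\<in>insert 0 (set l). transition l a * tri_up a ^ j * F (raise l a))"

text \<open>Functions of weight less than \<open>n\<close>, where a symmetric function of degree \<open>d\<close> in the values
  \<open>c (c - 1) / 2\<close> has weight \<open>2 d\<close> and the \<open>k\<close>-th power sum has weight \<open>k + 1\<close>.\<close>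

inductive weight_below :: "nat \<Rightarrow> (nat list \<Rightarrow> real) \<Rightarrow> bool" where
  zero: "weight_below n (\<lambda>l. 0)"
| sf: "sym_of_degree d Q \<Longrightarrow> 2 * d < n \<Longrightarrow> weight_below n (\<lambda>l. sf_eval Q (content_binoms l))"
| psum: "weight_below n F \<Longrightarrow> weight_below (n + Suc k) (\<lambda>l. content_psum k l * F l)"
| add: "weight_below n F \<Longrightarrow> weight_below n G \<Longrightarrow> weight_below n (\<lambda>l. F l + G l)"
| scale: "weight_below n F \<Longrightarrow> weight_below n (\<lambda>l. c * F l)"
| mono: "weight_below n F \<Longrightarrow> n \<le> m \<Longrightarrow> weight_below m F"
| cong: "weight_below n F \<Longrightarrow> (\<And>l. strict_partition l \<Longrightarrow> F l = G l) \<Longrightarrow> weight_below n G"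

text \<open>With bound 0 the rule \<open>sf\<close> cannot apply and \<open>psum\<close> only yields
  positive bounds. This is where repeated differencing stops.\<close>

lemma weight_below_0: "weight_below n F \<Longrightarrow> n = 0 \<Longrightarrow> strict_partition l \<Longrightarrow> F l = 0"
  by (induction arbitrary: l rule: weight_below.induct) auto

lemma weight_below_sum:
  "(\<And>i. i \<in> I \<Longrightarrow> weight_below n (F i)) \<Longrightarrow> weight_below n (\<lambda>l. \<Sum>i\<in>I. F i l)"
  by (induction I rule: infinite_finite_induct) (auto intro: zero add)

lemma weight_below_node_psum:
  assumes "weight_below n F" "r \<ge> 1"
  shows "weight_below (n + r) (\<lambda>l. node_psum r l * F l)"
proof (rule cong)
  let ?g = "second_difference r"
  show "weight_below (n + r) (\<lambda>l. \<Sum>j\<le>degree ?g. coeff ?g j * (content_psum j l * F l))"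
  proof (intro weight_below_sum scale)
    fix j assume "j \<in> {..degree ?g}"
    then have "n + Suc j \<le> n + r" using degree_second_difference[of r] assms(2) by simp
    then show "weight_below (n + r) (\<lambda>l. content_psum j l * F l)"
      using mono[OF psum[OF assms(1)]] by blast
  qed
  show "(\<Sum>j\<le>degree ?g. coeff ?g j * (content_psum j l * F l)) = node_psum r l * F l"
    if "strict_partition l" for l
    by (simp only: node_psum_eq[OF that assms(2)] sum_distrib_right mult.assoc)
qed

text \<open>In each term of Newton's recursion the index \<open>Suc r\<close> of the node power sum
  and the index k - r of the moment add up to \<open>Suc k\<close>.\<close>

lemma weight_below_transition_moment:
  assumes "weight_below n F"
  shows "weight_below (n + j) (\<lambda>l. transition_moment j l * F l)"
proof (induction j rule: less_induct)
  case (less j)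
  show ?case
  proof (cases j)
    case 0
    show ?thesis by (rule cong[OF mono[OF assms]]) (auto simp: 0 transition_moment_0)
  next
    case (Suc k)
    show ?thesis
    proof (rule cong)
      show "weight_below (n + j) (\<lambda>l. 1 / real (Suc k) * (\<Sum>r\<le>k. node_psum (Suc r) l * (transition_moment (k - r) l * F l)))"
      proof (intro scale weight_below_sum)
        fix r assume r: "r \<in> {..k}"
        have "weight_below (n + (k - r) + Suc r) (\<lambda>l. node_psum (Suc r) l * (transition_moment (k - r) l * F l))"
          by (intro weight_below_node_psum less) (auto simp: Suc)
        then show "weight_below (n + j) (\<lambda>l. node_psum (Suc r) l * (transition_moment (k - r) l * F l))"
          using r by (simp add: Suc)
      qed
      fix l assume "strict_partition l"
      then have "(\<Sum>r\<le>k. node_psum (Suc r) l * (transition_moment (k - r) l * F l)) = real (Suc k) * transition_moment (Suc k) l * F l"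
        by (simp only: transition_moment_newton sum_distrib_right mult.assoc)
      then show "1 / real (Suc k) * (\<Sum>r\<le>k. node_psum (Suc r) l * (transition_moment (k - r) l * F l)) = transition_moment j l * F l"
        by (simp add: Suc)
    qed
  qed
qed

lemma transition_avg_sf_eval:
  assumes Q: "sym_of_degree d Q" and l: "strict_partition l"
  shows "transition_avg j (\<lambda>l. sf_eval Q (content_binoms l)) l
    = (\<Sum>i\<le>d. transition_moment (i + j) l * sf_eval (coeff_fn Q i) (content_binoms l))"
proof -
  have e: "sf_eval Q (content_binoms (raise l a)) = (\<Sum>i\<le>d. tri_up a ^ i * sf_eval (coeff_fn Q i) (content_binoms l))"
    if "a \<in> insert 0 (set l)" for a
    using sf_eval_mset_eq[OF Q content_binoms_raise[OF l that]] sf_eval_Cons[OF Q] by (simp add: tri_up_def)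
  have "transition_avg j (\<lambda>l. sf_eval Q (content_binoms l)) l
    = (\<Sum>a\<in>insert 0 (set l). \<Sum>i\<le>d. transition l a * tri_up a ^ (i + j) * sf_eval (coeff_fn Q i) (content_binoms l))"
    unfolding transition_avg_def
    by (intro sum.cong refl) (simp only: e sum_distrib_left power_add mult_ac)
  also have "\<dots> = (\<Sum>i\<le>d. \<Sum>a\<in>insert 0 (set l). transition l a * tri_up a ^ (i + j) * sf_eval (coeff_fn Q i) (content_binoms l))"
    by (rule sum.swap)
  finally show ?thesis
    by (simp only: transition_moment_def moment_def transition_def sum_distrib_right)
qed

text \<open>Averaging acts as multiplication by a moment up to lower weight. Generality in j is
  forced by the product case, where the hypothesis is used at both j and j + k.\<close>

lemma weight_below_transition_avg:
  "weight_below n F \<Longrightarrow> weight_below (n + j - 1) (\<lambda>l. transition_avg j F l - transition_moment j l * F l)"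
proof (induction arbitrary: j rule: weight_below.induct)
  case (zero n)
  show ?case by (rule cong[OF weight_below.zero]) (simp add: transition_avg_def)
next
  case (sf d Q n)
  let ?E = "\<lambda>i l. transition_moment (i + j) l * sf_eval (coeff_fn Q i) (content_binoms l)"
  show ?case
  proof (rule cong)
    \<comment> \<open>The term i = 0 is the subtracted one. The i-th term has weight at most 2 (d -
      i) + i + j, which is i less than 2 d + j.\<close>
    show "weight_below (n + j - 1) (\<lambda>l. \<Sum>i\<in>{1..d}. ?E i l)"
    proof (rule weight_below_sum)
      fix i assume i: "i \<in> {1..d}"
      have "weight_below (Suc (2 * (d - i)) + (i + j)) (?E i)"
        by (intro weight_below_transition_moment weight_below.sf[OF sym_of_degree_coeff_fn[OF sf(1)]]) simp
      then show "weight_below (n + j - 1) (?E i)"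
        by (rule mono) (use i sf(2) in auto)
    qed
    fix l assume l: "strict_partition l"
    have "{..d} = insert 0 {1..d}" by auto
    then have "(\<Sum>i\<le>d. ?E i l) = ?E 0 l + (\<Sum>i\<in>{1..d}. ?E i l)" by simp
    then show "(\<Sum>i\<in>{1..d}. ?E i l) = transition_avg j (\<lambda>l. sf_eval Q (content_binoms l)) l
        - transition_moment j l * sf_eval Q (content_binoms l)"
      by (simp add: transition_avg_sf_eval[OF sf(1) l] sf_eval_coeff_fn_0[OF sf(1)])
  qed
next
  case (psum n F k)
  show ?case
  \<comment> \<open>For n = j = 0 the truncated subtraction in n + j - 1 makes the induction
    hypothesis too weak by one, but then F vanishes on strict partitions.\<close>
  proof (cases "n = 0")
    case True
    have z: "strict_partition l \<Longrightarrow> F l = 0" for l using weight_below_0[OF psum(1) True] .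
    show ?thesis
    proof (rule cong[OF weight_below.zero])
      fix l assume l: "strict_partition l"
      have "transition l a * F (raise l a) = 0" if "a \<in> insert 0 (set l)" for a
        using z[OF strict_partition_raise[OF l, of a]] transition_eq_0[OF that] by (cases "Suc a \<in> set l") auto
      then have "transition_avg j (\<lambda>l. content_psum k l * F l) l = 0"
        unfolding transition_avg_def by (intro sum.neutral) (auto simp: mult_ac)
      then show "0 = transition_avg j (\<lambda>l. content_psum k l * F l) l - transition_moment j l * (content_psum k l * F l)"
        by (simp add: z[OF l])
    qed
  next
    case False
    show ?thesis
    proof (rule cong)
      \<comment> \<open>The raised power sum is the old one plus \<open>tri_up a ^ k\<close>. The
        old one leads to \<open>?A\<close>, the new term to \<open>?B + ?C\<close>. The bound n + j
        + k of \<open>?C\<close> is exactly n + \<open>Suc k\<close> + j - 1.\<close>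
      let ?A = "\<lambda>l. content_psum k l * (transition_avg j F l - transition_moment j l * F l)"
      let ?B = "\<lambda>l. transition_avg (j + k) F l - transition_moment (j + k) l * F l"
      let ?C = "\<lambda>l. transition_moment (j + k) l * F l"
      have "weight_below (n + j - 1 + Suc k) ?A" by (intro weight_below.psum psum.IH)
      then have A: "weight_below (n + Suc k + j - 1) ?A" by (rule mono) (use False in simp)
      have B: "weight_below (n + Suc k + j - 1) ?B" using psum.IH[of "j + k"] by (rule mono) simp
      have C: "weight_below (n + Suc k + j - 1) ?C" using weight_below_transition_moment[OF psum(1), of "j + k"] by (rule mono) simp
      show "weight_below (n + Suc k + j - 1) (\<lambda>l. ?A l + (?B l + ?C l))"
        by (intro add A B C)
      fix l assume l: "strict_partition l"
      have "transition_avg j (\<lambda>l. content_psum k l * F l) l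
        = (\<Sum>a\<in>insert 0 (set l). transition l a * tri_up a ^ (j + k) * F (raise l a)
            + content_psum k l * (transition l a * tri_up a ^ j * F (raise l a)))"
        unfolding transition_avg_def
        by (intro sum.cong refl) (simp only: content_psum_raise[OF l], simp add: power_add algebra_simps)
      also have "\<dots> = transition_avg (j + k) F l + content_psum k l * transition_avg j F l"
        by (simp only: transition_avg_def sum.distrib sum_distrib_left)
      finally show "?A l + (?B l + ?C l) = transition_avg j (\<lambda>l. content_psum k l * F l) l
          - transition_moment j l * (content_psum k l * F l)"
        by (simp add: algebra_simps)
    qed
  qed
next
  case (add n F G)
  have "weight_below (n + j - 1) (\<lambda>l. (transition_avg j F l - transition_moment j l * F l)
      + (transition_avg j G l - transition_moment j l * G l))"
    by (intro weight_below.add add.IH)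
  then show ?case by (rule cong) (simp add: transition_avg_def algebra_simps sum.distrib)
next
  case (scale n F c)
  have "weight_below (n + j - 1) (\<lambda>l. c * (transition_avg j F l - transition_moment j l * F l))"
    by (intro weight_below.scale scale.IH)
  then show ?case
    by (rule cong) (simp add: transition_avg_def right_diff_distrib sum_distrib_left mult_ac)
next
  case (mono n F m)
  show ?case by (rule weight_below.mono[OF mono.IH]) (use mono in simp)
next
  case (cong n F G)
  show ?case
  proof (rule weight_below.cong[OF cong.IH])
    fix l assume l: "strict_partition l"
    \<comment> \<open>Where \<open>Suc a\<close> is already a part, F and G may differ at
      \<open>raise l a\<close>, but the weight is 0.\<close>
    have "transition l a * tri_up a ^ j * F (raise l a) = transition l a * tri_up a ^ j * G (raise l a)"
      if "a \<in> insert 0 (set l)" for a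
      using cong(2)[OF strict_partition_raise[OF l, of a]] transition_eq_0[OF that] by (cases "Suc a \<in> set l") auto
    then have "transition_avg j F l = transition_avg j G l"
      unfolding transition_avg_def by (intro sum.cong refl)
    then show "transition_avg j F l - transition_moment j l * F l = transition_avg j G l - transition_moment j l * G l"
      using cong(2)[OF l] by simp
  qed
qed

section \<open>Sums over the partitions containing a fixed one\<close>

definition partitions_above :: "nat list \<Rightarrow> nat \<Rightarrow> nat list set" where
  "partitions_above m n = {l. strict_partition l \<and> pcontains l m \<and> psize l = psize m + n}"

definition plancherel_sum :: "nat list \<Rightarrow> (nat list \<Rightarrow> real) \<Rightarrow> nat \<Rightarrow> real" where
  "plancherel_sum m F n = (\<Sum>l\<in>partitions_above m n. real (num_syt l m) * plancherel_weight l * F l)"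

text \<open>The nodes that do not give a cover have weight 0, so the sum over covers extends to all
  nodes.\<close>

lemma sum_covers:
  assumes k: "strict_partition k"
  shows "(\<Sum>l\<in>{l. covers k l}. plancherel_weight l * F l) = plancherel_weight k * transition_avg 0 F k"
proof -
  let ?A = "{a \<in> insert 0 (set k). Suc a \<notin> set k}"
  have "(\<Sum>l\<in>{l. covers k l}. plancherel_weight l * F l) = (\<Sum>a\<in>?A. plancherel_weight (raise k a) * F (raise k a))"
    unfolding covers_eq_raise[OF k] using inj_on_raise[OF k] by (subst sum.reindex) (auto intro: inj_on_subset)
  also have "\<dots> = (\<Sum>a\<in>?A. plancherel_weight k * (transition k a * F (raise k a)))"
    by (intro sum.cong refl) (auto simp: plancherel_weight_raise[OF k])
  also have "\<dots> = (\<Sum>a\<in>insert 0 (set k). plancherel_weight k * (transition k a * F (raise k a)))"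
    by (rule sum.mono_neutral_left) (use transition_eq_0 in fastforce)+
  finally show ?thesis by (simp only: transition_avg_def sum_distrib_left power_0 mult_1_right)
qed

lemma covers_pcontains: "covers k l \<Longrightarrow> pcontains l k"
  by (auto simp: covers_def pcontains_iff_subset)

lemma pcontains_trans: "pcontains l k \<Longrightarrow> pcontains k m \<Longrightarrow> pcontains l m"
  by (auto simp: pcontains_def intro: order.trans)

text \<open>Double counting of cover pairs: the tableau recurrence expands over the lower partition
  k, and after exchanging sums the upper partition l is averaged out.\<close>

lemma plancherel_sum_Suc:
  assumes m: "strict_partition m"
  shows "plancherel_sum m F (Suc n) = plancherel_sum m (transition_avg 0 F) n"
proof -
  let ?A = "partitions_above m (Suc n)" and ?B = "partitions_above m n"
  have fin: "finite ?A" "finite ?B" unfolding partitions_above_def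
    using finite_strict_partitions[of "\<lambda>l. pcontains l m"] by auto
  have "{k. covers k l \<and> pcontains k m} = {k \<in> ?B. covers k l}" if "l \<in> ?A" for l
    using that by (auto simp: partitions_above_def psize_covers) (auto simp: covers_def)
  moreover have "num_syt l m = (\<Sum>k\<in>{k. covers k l \<and> pcontains k m}. num_syt k m)" if "l \<in> ?A" for l
    using that by (intro num_syt_recurrence m) (auto simp: partitions_above_def)
  ultimately have "plancherel_sum m F (Suc n)
      = (\<Sum>l\<in>?A. \<Sum>k\<in>{k \<in> ?B. covers k l}. real (num_syt k m) * (plancherel_weight l * F l))"
    unfolding plancherel_sum_def by (intro sum.cong refl) (simp add: sum_distrib_right mult.assoc)
  also have "\<dots> = (\<Sum>k\<in>?B. \<Sum>l\<in>{l \<in> ?A. covers k l}. real (num_syt k m) * (plancherel_weight l * F l))"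
    by (rule sum.swap_restrict[OF fin])
  also have "\<dots> = (\<Sum>k\<in>?B. real (num_syt k m) * (\<Sum>l\<in>{l. covers k l}. plancherel_weight l * F l))"
  proof (intro sum.cong refl)
    fix k assume "k \<in> ?B"
    then have "{l \<in> ?A. covers k l} = {l. covers k l}"
      by (auto simp: partitions_above_def psize_covers intro: pcontains_trans[OF covers_pcontains])
        (auto simp: covers_def)
    then show "(\<Sum>l\<in>{l \<in> ?A. covers k l}. real (num_syt k m) * (plancherel_weight l * F l))
        = real (num_syt k m) * (\<Sum>l\<in>{l. covers k l}. plancherel_weight l * F l)"
      by (simp add: sum_distrib_left)
  qed
  also have "\<dots> = plancherel_sum m (transition_avg 0 F) n"
    unfolding plancherel_sum_def
    by (intro sum.cong refl) (simp add: partitions_above_def sum_covers)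
  finally show ?thesis .
qed

section \<open>Discrete antiderivatives of polynomials\<close>

lemma power_antidifference:
  "\<exists>q :: real poly. \<forall>n :: nat. poly q (real (Suc n)) - poly q (real n) = real n ^ k"
proof (induction k rule: less_induct)
  case (less k)
  then obtain q where q: "\<And>i n. i < k \<Longrightarrow> poly (q i) (real (Suc n)) - poly (q i) (real n) = real n ^ i"
    by metis
  let ?c = "\<lambda>i. real (Suc k choose i)"
  \<comment> \<open>The difference of n^(k + 1) has the top term (k + 1) n^k; its lower powers are
    removed by their own antiderivatives.\<close>
  let ?p = "smult (1 / real (Suc k)) (monom 1 (Suc k) - (\<Sum>i<k. smult (?c i) (q i)))"
  have "poly ?p (real (Suc n)) - poly ?p (real n) = real n ^ k" for n
  proof -
    have "real (Suc n) ^ Suc k = (\<Sum>i\<le>Suc k. ?c i * real n ^ i)"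
      using binomial_ring[of "real n" 1 "Suc k"] by (simp add: add.commute)
    then have b: "real (Suc n) ^ Suc k - real n ^ Suc k = (\<Sum>i<k. ?c i * real n ^ i) + real (Suc k) * real n ^ k"
      by (simp add: lessThan_Suc_atMost[symmetric])
    have "poly ?p (real (Suc n)) - poly ?p (real n) = 1 / real (Suc k) *
       ((real (Suc n) ^ Suc k - real n ^ Suc k) - (\<Sum>i<k. ?c i * (poly (q i) (real (Suc n)) - poly (q i) (real n))))"
      by (simp only: poly_smult poly_diff poly_sum poly_monom right_diff_distrib sum_subtractf mult_1)
    also have "(\<Sum>i<k. ?c i * (poly (q i) (real (Suc n)) - poly (q i) (real n))) = (\<Sum>i<k. ?c i * real n ^ i)"
      by (intro sum.cong refl) (simp only: q lessThan_iff)
    finally show ?thesis unfolding b by simp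
  qed
  then show ?case by blast
qed

lemma poly_antidifference:
  "\<exists>q :: real poly. \<forall>n :: nat. poly q (real (Suc n)) - poly q (real n) = poly p (real n)"
proof -
  obtain q :: "nat \<Rightarrow> real poly" where q: "\<And>k n :: nat. poly (q k) (real (Suc n)) - poly (q k) (real n) = real n ^ k"
    using power_antidifference by metis
  let ?r = "\<Sum>i\<le>degree p. smult (coeff p i) (q i)"
  have "poly ?r (real (Suc n)) - poly ?r (real n) = poly p (real n)" for n
  proof -
    have "poly ?r (real (Suc n)) - poly ?r (real n)
        = (\<Sum>i\<le>degree p. coeff p i * (poly (q i) (real (Suc n)) - poly (q i) (real n)))"
      by (simp only: poly_sum poly_smult right_diff_distrib sum_subtractf)
    then show ?thesis by (simp only: q) (simp only: poly_altdef)
  qed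
  then show ?thesis by blast
qed

text \<open>As the zeroth moment is 1, the first difference in n is the sum for \<open>?D\<close>,
  whose weight bound is smaller by one; its polynomial is then summed up.\<close>

lemma plancherel_sum_polynomial:
  assumes m: "strict_partition m"
  shows "weight_below w F \<Longrightarrow> \<exists>p. \<forall>n. plancherel_sum m F n = poly p (real n)"
proof (induction w arbitrary: F)
  case 0
  have "plancherel_sum m F n = poly 0 (real n)" for n
    using weight_below_0[OF 0] by (auto simp: plancherel_sum_def partitions_above_def intro!: sum.neutral)
  then show ?case by blast
next
  case (Suc w)
  let ?D = "\<lambda>l. transition_avg 0 F l - transition_moment 0 l * F l"
  have "weight_below w ?D" using weight_below_transition_avg[OF Suc.prems, of 0] by simp
  then obtain p where p: "\<And>n. plancherel_sum m ?D n = poly p (real n)" using Suc.IH by blast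
  obtain q :: "real poly" where q: "\<And>n :: nat. poly q (real (Suc n)) - poly q (real n) = poly p (real n)"
    using poly_antidifference by blast
  have step: "plancherel_sum m F (Suc n) - plancherel_sum m F n = poly p (real n)" for n
  proof -
    have "plancherel_sum m (transition_avg 0 F) n - plancherel_sum m F n = plancherel_sum m ?D n"
      unfolding plancherel_sum_def sum_subtractf[symmetric]
      by (intro sum.cong refl) (simp add: partitions_above_def transition_moment_0 right_diff_distrib)
    then show ?thesis by (simp add: plancherel_sum_Suc[OF m] p)
  qed
  \<comment> \<open>The constant adjusts the value at 0; beyond that the two sides have equal
    differences.\<close>
  have "plancherel_sum m F n = poly (q + [:plancherel_sum m F 0 - poly q 0:]) (real n)" for n
  proof (induction n)
    case (Suc n)
    then show ?case using step[of n] q[of n] by simp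
  qed simp
  then show ?case by blast
qed

theorem theorem1p1:
  fixes Q :: "(nat \<Rightarrow> nat) \<Rightarrow> real" and \<mu> :: "nat list"
  assumes "symmetric_function Q" and "strict_partition \<mu>"
  shows "\<exists>p :: real poly. \<forall>n. Pfun Q \<mu> n = poly p (real n)"
proof -
  obtain d where "sym_of_degree d Q" using symmetric_function_degree[OF assms(1)] by blast
  then have "weight_below (Suc (2 * d)) (\<lambda>l. sf_eval Q (content_binoms l))" by (rule sf) simp
  then obtain p where p: "\<And>n. plancherel_sum \<mu> (\<lambda>l. sf_eval Q (content_binoms l)) n = poly p (real n)"
    using plancherel_sum_polynomial[OF assms(2)] by blast
  \<comment> \<open>The powers of 2 that \<open>plancherel_weight\<close> leaves out.\<close>
  let ?c = "2 ^ length \<mu> / 2 ^ psize \<mu> :: real"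
  have "Pfun Q \<mu> n = ?c * plancherel_sum \<mu> (\<lambda>l. sf_eval Q (content_binoms l)) n" for n
    unfolding Pfun_def plancherel_sum_def sum_distrib_left partitions_above_def
    by (intro sum.cong refl) (simp add: plancherel_weight_def power_add)
  then have "\<forall>n. Pfun Q \<mu> n = poly (smult ?c p) (real n)" by (simp add: p)
  then show ?thesis by blast
qed

end
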